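(* Let $u\in\mathbb{Q}$ and let $$g_u(t)=t^{-1}\prod_{i=0}^{\infty}\bigl(1+u\,t^{-2^i}\bigr)\in\mathbb{Q}((t^{-1})),$$ the Laurent series solution of the Mahler equation $g_u(t)=(t+u)\,g_u(t^2)$. If $u\notin\{-1,0,1\}$, then $g_u\in\mathbf{ELC}_{1/2}$. If $u=-1$, then $g_u\in\mathbf{Bad}_{1/2}\setminus\mathbf{ELC}$.
   Context: Let $\mathbb{F}$ be a field (here $\mathbb{F}=\mathbb{Q}$). Write $\alpha\in\mathbb{F}((t^{-1}))$ as $\alpha=\sum_{k=-h}^{\infty}a_kt^{-k}$ with $a_{-h}\neq0$, and put $|\alpha|=2^{h}$ (and $|0|=0$). Define $\|\alpha\|=\min_{p\in\mathbb{F}[t]}|\alpha-p|=\bigl|\sum_{k\ge1}a_kt^{-k}\bigr|$. For $\delta>0$, $\mathbf{ELC}_\delta$ is the set of $\alpha\in\mathbb{F}((t^{-1}))$ such that $\inf_{q\in\mathbb{F}[t]\setminus\{0\},\,k\ge0}|q|\cdot\|q\,t^k\alpha\|\ge\delta$. $\mathbf{ELC}$ is the set of $\alpha$ for which this infimum is $>0$; this is the set of counterexamples to the $t$-adic Littlewood conjecture. $\mathbf{Bad}_\delta$ is the set of $\alpha$ with $\liminf_{q\in\mathbb{F}[t],\,|q|\to\infty}|q|\cdot\|q\alpha\|\ge\delta$. *)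

theory Defs
  imports
    "HOL-Complex_Analysis.Laurent_Convergence"
    "HOL-Computational_Algebra.Formal_Laurent_Series"
begin

unbundle fps_syntax
no_notation vec_nth (infixl "$" 90)

text \<open>
  The field \<open>F((t\<^sup>-\<^sup>1))\<close> is rendered as \<^typ>\<open>'a fls\<close> with the formal variable in the role of
  \<open>t\<^sup>-\<^sup>1\<close>: the coefficient of \<open>t\<^sup>-\<^sup>k\<close> in \<open>\<alpha>\<close> is \<open>\<alpha> $$ k\<close>, the element \<open>t\<close> is \<^const>\<open>fls_X_inv\<close>
  and \<open>t\<^sup>-\<^sup>1\<close> is \<^const>\<open>fls_X\<close>. The leading exponent \<open>h\<close> of \<open>\<alpha>\<close> in \<open>t\<close> is thus
  \<open>- fls_subdegree \<alpha>\<close>.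
\<close>

definition ls_abs :: "'a::field fls \<Rightarrow> real" where
  "ls_abs \<alpha> = (if \<alpha> = 0 then 0 else 2 powi (- fls_subdegree \<alpha>))"

text \<open>The embedding of \<open>F[t]\<close> into \<open>F((t\<^sup>-\<^sup>1))\<close>, i.e. evaluation at \<open>t\<close>.\<close>

definition ls_of_poly :: "'a::field poly \<Rightarrow> 'a fls" where
  "ls_of_poly q = poly (map_poly fls_const q) fls_X_inv"

text \<open>
  The infimum is attained, and it equals the absolute value of the fractional part;
  see \<open>ls_norm_eq\<close> and \<open>ls_norm_is_min\<close> below.
\<close>

definition ls_norm :: "'a::field fls \<Rightarrow> real" where
  "ls_norm \<alpha> = (INF p. ls_abs (\<alpha> - ls_of_poly p))"

definition littlewood_inf :: "'a::field fls \<Rightarrow> real" where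
  "littlewood_inf \<alpha> = (INF (q, k::nat) \<in> (UNIV - {0}) \<times> UNIV.
     ls_abs (ls_of_poly q) * ls_norm (ls_of_poly q * fls_X_inv ^ k * \<alpha>))"

definition ELC_delta :: "real \<Rightarrow> 'a::field fls set" where
  "ELC_delta \<delta> = {\<alpha>. littlewood_inf \<alpha> \<ge> \<delta>}"

definition ELC :: "'a::field fls set" where
  "ELC = {\<alpha>. littlewood_inf \<alpha> > 0}"

definition Bad_delta :: "real \<Rightarrow> 'a::field fls set" where
  "Bad_delta \<delta> = {\<alpha>.
     Liminf (filtercomap (\<lambda>q. ls_abs (ls_of_poly q)) at_top)
       (\<lambda>q. ereal (ls_abs (ls_of_poly q) * ls_norm (ls_of_poly q * \<alpha>))) \<ge> ereal \<delta>}"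

text \<open>
  The infinite product is taken in the topology of \<^typ>\<open>'a fls\<close>, which is the one induced
  by \<^const>\<open>ls_abs\<close>; convergence is \<open>mahler_product_convergent\<close> below.
\<close>

definition mahler_g :: "'a::field \<Rightarrow> 'a fls" where
  "mahler_g u = fls_X * (\<Prod>i. 1 + fls_const u * fls_X ^ (2 ^ i))"


lemma dist_fls_eq_ls_abs: "dist \<alpha> \<beta> = ls_abs (\<alpha> - \<beta>)"
  by (auto simp: dist_fls_def ls_abs_def power_int_def power_one_over inverse_eq_divide)

lemma ls_abs_nonneg [simp]: "ls_abs \<alpha> \<ge> 0"
  by (simp add: ls_abs_def)

lemma ls_of_poly_nth:
  "ls_of_poly q $$ k = (if k \<le> 0 then coeff q (nat (- k)) else 0)"
proof (induction q arbitrary: k)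
  case 0
  then show ?case by (simp add: ls_of_poly_def)
next
  case (pCons a q)
  have "ls_of_poly (pCons a q) = fls_const a + fls_X_inv * ls_of_poly q"
    by (simp add: ls_of_poly_def map_poly_pCons)
  also have "fls_X_inv * ls_of_poly q = fls_shift 1 (ls_of_poly q)"
    by (simp add: fls_X_inv_times_conv_shift)
  finally have eq: "ls_of_poly (pCons a q) $$ k = (if k = 0 then a else 0) + ls_of_poly q $$ (k + 1)"
    by simp
  show ?case
  proof (cases "k < 0")
    case True
    then have "nat (- k) = Suc (nat (- (k + 1)))" by simp
    then show ?thesis using True pCons.IH[of "k + 1"] eq by simp
  next
    case False
    then show ?thesis using pCons.IH[of "k + 1"] eq by auto
  qed
qed

lemma ls_abs_ls_of_poly:
  assumes "q \<noteq> 0"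
  shows "ls_abs (ls_of_poly q) = 2 ^ degree q"
proof -
  have nz: "ls_of_poly q $$ (- int (degree q)) \<noteq> 0"
    using assms by (simp add: ls_of_poly_nth)
  have "fls_subdegree (ls_of_poly q) = - int (degree q)"
  proof (rule fls_subdegree_eqI[OF nz])
    fix k assume "k < - int (degree q)"
    then show "ls_of_poly q $$ k = 0"
      by (auto simp: ls_of_poly_nth intro!: coeff_eq_0)
  qed
  moreover have "ls_of_poly q \<noteq> 0" using nz by auto
  ultimately show ?thesis by (simp add: ls_abs_def)
qed

definition ls_frac :: "'a::field fls \<Rightarrow> 'a fls" where
  "ls_frac \<alpha> = fps_to_fls (Abs_fps (\<lambda>n. if n = 0 then 0 else \<alpha> $$ int n))"

lemma ls_frac_nth: "ls_frac \<alpha> $$ k = (if k \<ge> 1 then \<alpha> $$ k else 0)"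
  by (simp add: ls_frac_def)

lemma ls_frac_diff_poly: "\<exists>p. \<alpha> - ls_of_poly p = ls_frac \<alpha>"
proof -
  define N where "N = nat (- fls_subdegree \<alpha>)"
  define p where "p = (\<Sum>i\<le>N. monom (\<alpha> $$ (- int i)) i)"
  have c: "coeff p i = \<alpha> $$ (- int i)" for i
  proof -
    have "coeff p i = (if i \<le> N then \<alpha> $$ (- int i) else 0)"
      by (simp add: p_def coeff_sum)
    moreover have "\<alpha> $$ (- int i) = 0" if "\<not> i \<le> N"
      using that by (intro fls_eq0_below_subdegree) (auto simp: N_def)
    ultimately show ?thesis by simp
  qed
  have "\<alpha> - ls_of_poly p = ls_frac \<alpha>"
    by (rule fls_eqI) (auto simp: ls_of_poly_nth ls_frac_nth c)
  then show ?thesis ..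
qed

lemma ls_frac_le: "ls_abs (ls_frac \<alpha>) \<le> ls_abs (\<alpha> - ls_of_poly p)"
proof (cases "ls_frac \<alpha> = 0")
  case True
  then show ?thesis by (simp add: ls_abs_def)
next
  case False
  define s where "s = fls_subdegree (ls_frac \<alpha>)"
  have nz: "ls_frac \<alpha> $$ s \<noteq> 0"
    using False by (simp add: s_def)
  then have s: "s \<ge> 1" "\<alpha> $$ s \<noteq> 0" by (auto simp: ls_frac_nth split: if_splits)
  then have d: "(\<alpha> - ls_of_poly p) $$ s \<noteq> 0" by (simp add: ls_of_poly_nth)
  then have "fls_subdegree (\<alpha> - ls_of_poly p) \<le> s" by (rule fls_subdegree_leI)
  moreover have "\<alpha> - ls_of_poly p \<noteq> 0" using d by force
  ultimately show ?thesis using False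
    by (simp add: ls_abs_def s_def power_int_increasing)
qed

lemma ls_norm_eq: "ls_norm \<alpha> = ls_abs (ls_frac \<alpha>)"
proof -
  obtain p where p: "\<alpha> - ls_of_poly p = ls_frac \<alpha>" using ls_frac_diff_poly by blast
  show ?thesis unfolding ls_norm_def
  proof (rule cInf_eq_minimum)
    show "ls_abs (ls_frac \<alpha>) \<in> range (\<lambda>p. ls_abs (\<alpha> - ls_of_poly p))"
      using p by (metis rangeI)
  qed (auto intro: ls_frac_le)
qed

lemma ls_norm_is_min:
  "\<exists>p. ls_abs (\<alpha> - ls_of_poly p) = ls_norm \<alpha>"
  "ls_norm \<alpha> \<le> ls_abs (\<alpha> - ls_of_poly p)"
  using ls_frac_diff_poly[of \<alpha>] ls_frac_le[of \<alpha>] by (auto simp: ls_norm_eq) metis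

lemma littlewood_inf_bdd_below:
  "bdd_below ((\<lambda>(q, k::nat). ls_abs (ls_of_poly q) * ls_norm (ls_of_poly q * fls_X_inv ^ k * \<alpha>)) ` A)"
  by (rule bdd_belowI[of _ 0]) (auto simp: ls_norm_eq)


definition mahler_partial :: "'a::field \<Rightarrow> nat \<Rightarrow> 'a fps" where
  "mahler_partial u n = (\<Prod>i\<le>n. 1 + fps_const u * fps_X ^ (2 ^ i))"

definition mahler_limit :: "'a::field \<Rightarrow> 'a fps" where
  "mahler_limit u = Abs_fps (\<lambda>k. mahler_partial u k $ k)"

lemma mahler_partial_nth_Suc:
  assumes "k < 2 ^ Suc n"
  shows "mahler_partial u (Suc n) $ k = mahler_partial u n $ k"
proof -
  have "mahler_partial u (Suc n) =
      mahler_partial u n + fps_const u * (mahler_partial u n * fps_X ^ (2 ^ Suc n))"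
    by (simp add: mahler_partial_def algebra_simps)
  then show ?thesis using assms
    by (simp only: fps_add_nth fps_mult_left_const_nth fps_X_power_mult_right_nth) simp
qed

lemma mahler_partial_nth:
  assumes "k \<le> n"
  shows "mahler_partial u n $ k = mahler_limit u $ k"
  using assms
proof (induction n rule: dec_induct)
  case base
  then show ?case by (simp add: mahler_limit_def)
next
  case (step n)
  have "k < 2 ^ Suc n"
    using step.hyps less_exp[of "Suc n"] by linarith
  then show ?case using mahler_partial_nth_Suc step.IH by metis
qed

lemma mahler_limit_nth_0: "mahler_limit u $ 0 = 1"
  by (simp add: mahler_limit_def mahler_partial_def)

lemma mahler_factor:
  "1 + fls_const u * fls_X ^ (2 ^ i) = fps_to_fls (1 + fps_const u * fps_X ^ (2 ^ i))"
  by (simp add: fls_times_fps_to_fls fps_to_fls_power)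

lemma mahler_product_has_prod:
  "(\<lambda>i. 1 + fls_const u * fls_X ^ (2 ^ i)) has_prod fps_to_fls (mahler_limit u)"
proof -
  have P: "(\<Prod>i\<le>n. 1 + fls_const u * fls_X ^ (2 ^ i)) = fps_to_fls (mahler_partial u n)" for n
  proof (induction n)
    case 0
    then show ?case by (simp add: mahler_partial_def fls_times_fps_to_fls)
  next
    case (Suc n)
    have "mahler_partial u (Suc n) = mahler_partial u n * (1 + fps_const u * fps_X ^ (2 ^ Suc n))"
      by (simp add: mahler_partial_def)
    then show ?case
      using Suc.IH mahler_factor[of u "Suc n"] by (simp only: prod.atMost_Suc fls_times_fps_to_fls)
  qed
  have "mahler_partial u \<longlonglongrightarrow> mahler_limit u"
    unfolding tendsto_fps_iff eventually_sequentially using mahler_partial_nth by blast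
  then have "(\<lambda>n. dist (mahler_partial u n) (mahler_limit u)) \<longlonglongrightarrow> 0"
    by (rule tendsto_dist_iff[THEN iffD1])
  moreover have "dist (fps_to_fls a) (fps_to_fls b) = dist a b" for a b :: "'a fps"
    by (simp add: dist_fls_def dist_fps_def fls_subdegree_fls_to_fps flip: fps_to_fls_minus)
  ultimately have "(\<lambda>n. fps_to_fls (mahler_partial u n)) \<longlonglongrightarrow> fps_to_fls (mahler_limit u)"
    by (subst tendsto_dist_iff) (simp only:)
  moreover have "mahler_limit u \<noteq> 0"
    using mahler_limit_nth_0[of u] by force
  ultimately show ?thesis
    unfolding has_prod_def raw_has_prod_def by (simp add: P)
qed

lemma mahler_product_convergent:
  "convergent_prod (\<lambda>i. 1 + fls_const (u :: 'a::field) * fls_X ^ (2 ^ i))"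
  using mahler_product_has_prod has_prod_def convergent_prod_def by blast

lemma mahler_g_eq: "mahler_g u = fls_X * fps_to_fls (mahler_limit u)"
  using has_prod_unique[OF mahler_product_has_prod[of u]] by (simp add: mahler_g_def)

lemma mahler_limit_functional:
  "mahler_limit u = (1 + fps_const u * fps_X) * (mahler_limit u oo fps_X ^ 2)"
proof (rule fps_ext)
  fix n
  have step: "mahler_partial u (Suc m) =
      (1 + fps_const u * fps_X) * (mahler_partial u m oo fps_X ^ 2)" for m
  proof -
    have "mahler_partial u m oo fps_X ^ 2 = (\<Prod>i\<le>m. 1 + fps_const u * fps_X ^ (2 ^ Suc i))"
      by (simp add: mahler_partial_def fps_compose_prod_distrib fps_compose_add_distrib
          fps_compose_mult_distrib fps_compose_power[symmetric] power_mult[symmetric])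
    then show ?thesis
      by (simp only: mahler_partial_def prod.atMost_Suc_shift) simp
  qed
  have eq: "(mahler_partial u n oo fps_X ^ 2) $ j = (mahler_limit u oo fps_X ^ 2) $ j"
    if "j \<le> n" for j
    using that by (auto simp: fps_nth_compose_X_power intro!: mahler_partial_nth
        order.trans[OF div_le_dividend])
  have "mahler_limit u $ n = mahler_partial u (Suc n) $ n"
    by (simp add: mahler_partial_nth)
  also have "\<dots> = ((1 + fps_const u * fps_X) * (mahler_limit u oo fps_X ^ 2)) $ n"
    unfolding step by (simp add: distrib_right mult.assoc eq)
  finally show "mahler_limit u $ n = \<dots>" .
qed

text \<open>Here \<^term>\<open>fls_compose_power f 2\<close> is \<open>f(t\<^sup>2)\<close>.\<close>

lemma mahler_g_equation:
  "mahler_g u = (fls_X_inv + fls_const u) * fls_compose_power (mahler_g u) 2"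
proof -
  define H where "H = fps_to_fls (mahler_limit u oo fps_X ^ 2)"
  have "mahler_g u = fls_X * ((1 + fls_const u * fls_X) * H)"
    by (subst mahler_g_eq, subst mahler_limit_functional)
       (simp add: H_def fls_times_fps_to_fls)
  moreover have "fls_compose_power (mahler_g u) 2 = fls_X ^ 2 * H"
    by (simp add: mahler_g_eq H_def fls_compose_power_fps_to_fls fls_X_power_conv_shift_1)
  moreover have "fls_X_inv * (fls_X * x) = x" for x :: "'a fls"
    by (simp add: fls_X_times_conv_shift fls_X_inv_times_conv_shift)
  ultimately show ?thesis
    by (simp add: distrib_left distrib_right power2_eq_square mult_ac)
qed

end

theory Submission
  imports Defs "HOL-Library.Z2"
begin

text \<open>
  Put \<open>a\<^sub>n = u\<^bsup>s(n)\<^esup>\<close> with \<open>s\<close> the binary digit sum, so \<open>g\<^sub>u = \<Sum>a\<^sub>n t\<^sup>-\<^sup>n\<^sup>-\<^sup>1\<close>. Membership in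
  \<open>ELC\<^sub>1\<^sub>/\<^sub>2\<close> says that every Hankel matrix \<open>(a\<^bsub>k+i+j\<^esub>)\<^bsub>i,j<n\<^esub>\<close> is nonsingular, i.e. that for all \<open>k, n\<close> there
  is a monic \<open>P\<close> of degree \<open>n\<close> orthogonal to all lower degrees under the functional \<open>t\<^sup>j \<mapsto> a\<^bsub>k+j\<^esub>\<close>, with
  norm \<open>h \<noteq> 0\<close>. For \<open>u \<notin> {-1, 0, 1}\<close> some prime \<open>p\<close> has \<open>v\<^sub>p(u) \<noteq> 0\<close>, and the \<open>p\<close>-adic
  valuations of \<open>h\<close> and of \<open>P(u\<^sup>2)\<close> can be computed exactly: splitting polynomials into even and
  odd parts, \<open>a\<^bsub>2m\<^esub> = a\<^sub>m\<close> and \<open>a\<^bsub>2m+1\<^esub> = u a\<^sub>m\<close> express the norm at \<open>(k, n)\<close> through norms and values at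
  \<open>u\<^sup>2\<close> at about \<open>(k/2, n/2)\<close>, while in the recurrence
  \<open>P\<^bsub>k,n+1\<^esub> = t P\<^bsub>k+1,n\<^esub> - (h\<^bsub>k+1,n\<^esub> / h\<^bsub>k,n\<^esub>) P\<^bsub>k,n\<^esub>\<close> evaluated at \<open>u\<^sup>2\<close> one of the two terms always
  dominates.

  For \<open>u = -1\<close> and \<open>k = 0\<close> one reduces modulo 2: adding consecutive rows and halving leads to the
  series \<open>E\<close> over \<open>GF(2)\<close> with \<open>E\<^sup>2 + (t + 1) E + 1 = 0\<close>, whose partial quotients are all \<open>t + 1\<close>.
  Finally \<open>t\<^sup>M + 1\<close> with \<open>M = 2\<^sup>m\<close> annihilates \<open>3 M\<close> consecutive coefficients of \<open>t\<^bsup>2M\<^esup> g\<^bsub>-1\<^esub>\<close>, because the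
  Thue--Morse word contains the alternating factor \<open>1 0 1 0\<close> at position 2.
\<close>

section \<open>Orthogonal polynomials of a moment sequence\<close>

definition moment :: "(nat \<Rightarrow> 'a::field) \<Rightarrow> nat \<Rightarrow> 'a poly \<Rightarrow> 'a" where
  "moment a k p = (\<Sum>j\<le>degree p. coeff p j * a (k + j))"

lemma moment_eq_sum:
  assumes "degree p \<le> n"
  shows "moment a k p = (\<Sum>j\<le>n. coeff p j * a (k + j))"
  unfolding moment_def
  by (rule sum.mono_neutral_left) (use assms in \<open>auto intro: coeff_eq_0\<close>)

lemma moment_0 [simp]: "moment a k 0 = 0"
  by (simp add: moment_def)

lemma moment_1 [simp]: "moment a k 1 = a k"
  by (simp add: moment_def)

lemma moment_pCons [simp]: "moment a k (pCons c p) = c * a k + moment a (Suc k) p"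
proof -
  have "moment a k (pCons c p) = (\<Sum>j\<le>Suc (degree p). coeff (pCons c p) j * a (k + j))"
    by (rule moment_eq_sum) (simp add: degree_pCons_le)
  then show ?thesis
    by (subst (asm) sum.atMost_Suc_shift) (simp add: moment_def)
qed

lemma moment_add [simp]: "moment a k (p + q) = moment a k p + moment a k q"
proof -
  define n where "n = max (degree p) (degree q)"
  have "degree p \<le> n" "degree q \<le> n" "degree (p + q) \<le> n"
    by (auto simp: n_def degree_add_le_max)
  then show ?thesis
    by (simp add: moment_eq_sum[of _ n] distrib_right sum.distrib)
qed

lemma moment_smult [simp]: "moment a k (smult c p) = c * moment a k p"
  unfolding moment_eq_sum[OF degree_smult_le] by (simp add: moment_def sum_distrib_left mult.assoc)

lemma moment_diff [simp]: "moment a k (p - q) = moment a k p - moment a k q"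
  using moment_add[of a k "p - q" q] unfolding diff_add_cancel by (simp only: add_diff_cancel)

lemma moment_mult: "moment a k (p * q) = (\<Sum>j\<le>degree p. coeff p j * moment a (k + j) q)"
proof (induction p arbitrary: k)
  case 0
  then show ?case by simp
next
  case (pCons c p)
  have "moment a k (pCons c p * q) = c * moment a k q + (\<Sum>j\<le>degree p. coeff p j * moment a (Suc k + j) q)"
    using pCons.IH by (simp add: mult_pCons_left)
  also have "\<dots> = (\<Sum>j\<le>Suc (degree p). coeff (pCons c p) j * moment a (k + j) q)"
    by (subst sum.atMost_Suc_shift) simp
  also have "\<dots> = (\<Sum>j\<le>degree (pCons c p). coeff (pCons c p) j * moment a (k + j) q)"
    by (rule sum.mono_neutral_right) (auto simp: degree_pCons_eq_if intro: coeff_eq_0 split: if_splits)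
  finally show ?case .
qed

definition orth :: "(nat \<Rightarrow> 'a::field) \<Rightarrow> nat \<Rightarrow> nat \<Rightarrow> 'a poly \<Rightarrow> bool" where
  "orth a k n p \<longleftrightarrow> coeff p n = 1 \<and> degree p \<le> n \<and> (\<forall>i<n. moment a (k + i) p = 0)"

lemma orthD:
  assumes "orth a k n p"
  shows "coeff p n = 1" "degree p \<le> n" "\<And>i. i < n \<Longrightarrow> moment a (k + i) p = 0"
  using assms by (auto simp: orth_def)

lemma orth_pairing:
  assumes "orth a k n p" "degree q \<le> n"
  shows "moment a k (q * p) = coeff q n * moment a (k + n) p"
proof -
  have "moment a k (q * p) = (\<Sum>j\<le>n. coeff q j * moment a (k + j) p)"
    unfolding moment_mult
    by (rule sum.mono_neutral_left) (use assms in \<open>auto intro: coeff_eq_0\<close>)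
  also have "\<dots> = (\<Sum>j\<in>{n}. coeff q j * moment a (k + j) p)"
    by (rule sum.mono_neutral_right) (use assms in \<open>auto simp: orth_def\<close>)
  finally show ?thesis by simp
qed

text \<open>The functional takes the same value on \<open>p * q\<close> and \<open>q * p\<close>,
  and \<open>orth_pairing\<close> reads this value as either norm. Polynomials found in different
  ways may thus share one norm.\<close>

lemma orth_norm_unique:
  assumes "orth a k n p" "orth a k n q"
  shows "moment a (k + n) p = moment a (k + n) q"
  using orth_pairing[OF assms(1) orthD(2)[OF assms(2)]] orth_pairing[OF assms(2) orthD(2)[OF assms(1)]]
  by (simp add: orthD(1)[OF assms(1)] orthD(1)[OF assms(2)] mult.commute[of q p])

text \<open>The value on \<open>p * q\<close> is computed twice: expanding \<open>p\<close> gives a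
  combination of the moments of \<open>q\<close>, expanding \<open>q\<close> leaves its leading
  coefficient times the norm of \<open>p\<close>.\<close>

lemma orth_nondegenerate:
  assumes "orth a k (degree q) p" "moment a (k + degree q) p \<noteq> 0" "q \<noteq> 0"
  shows "\<exists>i\<le>degree q. moment a (k + i) q \<noteq> 0"
proof (rule ccontr)
  assume "\<not> ?thesis"
  then have "moment a k (p * q) = 0"
    unfolding moment_mult using orthD(2)[OF assms(1)] by (intro sum.neutral ballI) simp
  moreover have "moment a k (q * p) = lead_coeff q * moment a (k + degree q) p"
    using orth_pairing[OF assms(1)] by simp
  ultimately show False using assms(2,3) by (simp add: mult.commute[of q p])
qed

text \<open>Multiplication by t moves the base point from \<open>k\<close> to \<open>Suc k\<close>,
  so both terms have vanishing moments for \<open>i < n\<close>; the quotient of norms cancels the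
  remaining one at \<open>i = n\<close>.\<close>

lemma orth_step:
  assumes P: "orth a k n P" and P': "orth a (Suc k) n P'" and nz: "moment a (k + n) P \<noteq> 0"
  shows "orth a k (Suc n) (pCons 0 P' - smult (moment a (Suc k + n) P' / moment a (k + n) P) P)"
    (is "orth a k _ ?N")
proof -
  have "coeff P (Suc n) = 0" using orthD(2)[OF P] by (simp add: coeff_eq_0)
  then have "coeff ?N (Suc n) = 1"
    using orthD(1)[OF P'] by simp
  moreover have "degree ?N \<le> Suc n"
    using orthD(2)[OF P] orthD(2)[OF P']
    by (intro degree_diff_le le_trans[OF degree_smult_le] le_trans[OF degree_pCons_le]) simp_all
  moreover have "moment a (k + i) ?N = 0" if "i < Suc n" for i
  proof (cases "i = n")
    case False
    then show ?thesis
      using that orthD(3)[OF P, of i] orthD(3)[OF P', of i] by simp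
  qed (use nz in simp)
  ultimately show ?thesis unfolding orth_def by blast
qed

section \<open>Halving for Mahler sequences\<close>

definition interleave :: "'a::field poly \<Rightarrow> 'a poly \<Rightarrow> 'a poly" where
  "interleave p q = pcompose p [:0, 0, 1:] + pCons 0 (pcompose q [:0, 0, 1:])"

lemma coeff_pcompose_square:
  "coeff (pcompose p [:0, 0, 1 :: 'a::field:]) n = (if even n then coeff p (n div 2) else 0)"
proof (induction p arbitrary: n)
  case 0
  then show ?case by simp
next
  case (pCons c p)
  show ?case
  proof (cases n)
    case 0
    then show ?thesis by (simp add: pcompose_pCons)
  next
    case (Suc m)
    show ?thesis
    proof (cases m)
      case 0
      then show ?thesis using Suc by (simp add: pcompose_pCons)
    next
      case (Suc l)
      then show ?thesis using \<open>n = Suc m\<close> pCons.IH[of l] by (simp add: pcompose_pCons)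
    qed
  qed
qed

lemma coeff_interleave:
  "coeff (interleave p q) n = (if even n then coeff p (n div 2) else coeff q (n div 2))"
  unfolding interleave_def coeff_add coeff_pCons coeff_pcompose_square by (cases n) simp_all

lemma degree_interleave_le:
  assumes "\<And>i. n < 2 * i \<Longrightarrow> coeff p i = 0" "\<And>i. n < Suc (2 * i) \<Longrightarrow> coeff q i = 0"
  shows "degree (interleave p q) \<le> n"
proof (rule degree_le, intro allI impI)
  fix i assume "n < i"
  then show "coeff (interleave p q) i = 0"
    using assms(1)[of "i div 2"] assms(2)[of "i div 2"] by (auto simp: coeff_interleave)
qed

locale mahler_seq =
  fixes a :: "nat \<Rightarrow> 'a::field" and u :: 'a
  assumes a_even: "a (2 * m) = a m" and a_odd: "a (Suc (2 * m)) = u * a m"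
begin

lemma moment_square:
  "moment a (2 * k) (pcompose p [:0, 0, 1:]) = moment a k p"
  "moment a (Suc (2 * k)) (pcompose p [:0, 0, 1:]) = u * moment a k p"
proof (induction p arbitrary: k)
  case (pCons c p)
  {
    case 1
    have "moment a (2 * k) (pcompose (pCons c p) [:0, 0, 1:]) =
        c * a (2 * k) + moment a (2 * Suc k) (pcompose p [:0, 0, 1:])"
      by (simp add: pcompose_pCons)
    then show ?case unfolding pCons.IH(1) by (simp add: a_even)
  next
    case 2
    have "moment a (Suc (2 * k)) (pcompose (pCons c p) [:0, 0, 1:]) =
        c * a (Suc (2 * k)) + moment a (Suc (2 * Suc k)) (pcompose p [:0, 0, 1:])"
      by (simp add: pcompose_pCons)
    then show ?case unfolding pCons.IH(2) by (simp add: a_odd distrib_left mult.left_commute)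
  }
qed simp_all

text \<open>The part of the polynomial that meets odd indices picks up the factor \<open>u\<close>.
  The \<open>pCons 0\<close> arises because index \<open>2 * k + 2\<close> belongs to base point
  \<open>Suc k\<close>.\<close>

lemma moment_interleave:
  "moment a (2 * k) (interleave p q) = moment a k (p + smult u q)"
  "moment a (Suc (2 * k)) (interleave p q) = moment a k (smult u p + pCons 0 q)"
  using moment_square(1)[of "Suc k" q] by (simp_all add: interleave_def moment_square)

lemma orth_interleaveI:
  assumes "coeff (interleave p q) n = 1" "degree (interleave p q) \<le> n"
    and "\<And>i. 2 * i < n \<Longrightarrow> moment a (k + i) (p + smult u q) = 0"
    and "\<And>i. Suc (2 * i) < n \<Longrightarrow> moment a (k + i) (smult u p + pCons 0 q) = 0"
  shows "orth a (2 * k) n (interleave p q)"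
  unfolding orth_def
proof (intro conjI allI impI assms(1,2))
  fix i assume i: "i < n"
  show "moment a (2 * k + i) (interleave p q) = 0"
  proof (cases "even i")
    case True
    then obtain j where j: "i = 2 * j" by blast
    then show ?thesis using assms(3)[of j] i moment_interleave(1)[of "k + j" p q] by simp
  next
    case False
    then obtain j where j: "i = Suc (2 * j)" by (metis oddE Suc_eq_plus1)
    then show ?thesis using assms(4)[of j] i moment_interleave(2)[of "k + j" p q] by simp
  qed
qed

lemma orth_interleave_oddI:
  assumes "coeff (interleave p q) n = 1" "degree (interleave p q) \<le> n"
    and "\<And>i. 2 * i < n \<Longrightarrow> moment a (k + i) (smult u p + pCons 0 q) = 0"
    and "\<And>i. Suc (2 * i) < n \<Longrightarrow> moment a (Suc k + i) (p + smult u q) = 0"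
  shows "orth a (Suc (2 * k)) n (interleave p q)"
  unfolding orth_def
proof (intro conjI allI impI assms(1,2))
  fix i assume i: "i < n"
  show "moment a (Suc (2 * k) + i) (interleave p q) = 0"
  proof (cases "even i")
    case True
    then obtain j where j: "i = 2 * j" by blast
    then show ?thesis using assms(3)[of j] i moment_interleave(2)[of "k + j" p q] by simp
  next
    case False
    then obtain j where j: "i = Suc (2 * j)" by (metis oddE Suc_eq_plus1)
    then show ?thesis using assms(4)[of j] i moment_interleave(1)[of "Suc k + j" p q] by simp
  qed
qed

end

section \<open>Norms at doubled indices, in four parity cases\<close>

lemma monic_root_quotient:
  fixes p :: "'a::field poly"
  assumes "coeff p (Suc c) = 1" "degree p \<le> Suc c" "poly p x = 0"
  obtains q where "p = pCons 0 q - smult x q" "coeff q c = 1" "degree q \<le> c"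
proof -
  obtain q where q: "p = [:-x, 1:] * q"
    using assms(3) by (auto simp: poly_eq_0_iff_dvd)
  then have pq: "p = pCons 0 q - smult x q" by simp
  have "degree p = Suc c"
    using assms by (intro antisym le_degree) auto
  moreover have "q \<noteq> 0" using q assms(1) by auto
  ultimately have d: "degree q = c"
    using q degree_mult_eq[of "[:-x, 1:]" q] by simp
  then have "coeff q c = 1"
    using assms(1) unfolding pq by (simp add: coeff_eq_0)
  with that pq d show ?thesis by simp
qed

context mahler_seq
begin

lemma orth_even_even:
  assumes "orth a k c P"
  shows "orth a (2 * k) (2 * c) (interleave P 0)" "moment a (2 * k + 2 * c) (interleave P 0) = moment a (k + c) P"
proof -
  note P = orthD[OF assms]
  show "orth a (2 * k) (2 * c) (interleave P 0)"
  proof (rule orth_interleaveI)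
    show "degree (interleave P 0) \<le> 2 * c"
      using P(2) by (intro degree_interleave_le) (auto intro: coeff_eq_0)
  qed (use P in \<open>auto simp: coeff_interleave\<close>)
  show "moment a (2 * k + 2 * c) (interleave P 0) = moment a (k + c) P"
    using moment_interleave(1)[of "k + c"] by simp
qed

text \<open>Taking \<open>- u\<close> times the odd part as even part settles all even offsets. The
  odd offsets then concern (t - u^2) times the odd part, which is \<open>N - r P\<close> with
  \<open>r\<close> making it vanish at u^2.\<close>

lemma orth_even_odd:
  assumes P: "orth a k c P" and N: "orth a k (Suc c) N" and nz: "poly P (u\<^sup>2) \<noteq> 0"
  obtains R where "orth a (2 * k) (Suc (2 * c)) R"
    "moment a (2 * k + Suc (2 * c)) R = - (poly N (u\<^sup>2) / poly P (u\<^sup>2) * moment a (k + c) P)"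
proof -
  note oP = orthD[OF P] and oN = orthD[OF N]
  define r where "r = poly N (u\<^sup>2) / poly P (u\<^sup>2)"
  obtain Q where Q: "N - smult r P = pCons 0 Q - smult (u\<^sup>2) Q" "coeff Q c = 1" "degree Q \<le> c"
  proof (rule monic_root_quotient)
    show "coeff (N - smult r P) (Suc c) = 1" using oP(2) oN(1) by (simp add: coeff_eq_0)
    show "degree (N - smult r P) \<le> Suc c"
      using oP(2) oN(2) by (intro degree_diff_le order.trans[OF degree_smult_le]) auto
    show "poly (N - smult r P) (u\<^sup>2) = 0" using nz by (simp add: r_def)
  qed
  have Q': "moment a m (smult u (smult (- u) Q) + pCons 0 Q) = moment a m (N - smult r P)" for m
    by (simp add: Q(1) power2_eq_square)
  define R where "R = interleave (smult (- u) Q) Q"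
  have "orth a (2 * k) (Suc (2 * c)) R" unfolding R_def
  proof (rule orth_interleaveI)
    show "degree (interleave (smult (- u) Q) Q) \<le> Suc (2 * c)"
      using Q(3) by (intro degree_interleave_le) (auto intro: coeff_eq_0)
    show "moment a (k + i) (smult u (smult (- u) Q) + pCons 0 Q) = 0" if "Suc (2 * i) < Suc (2 * c)" for i
      unfolding Q' using that oP(3) oN(3) by simp
  qed (use Q(2) in \<open>auto simp: coeff_interleave\<close>)
  moreover have "moment a (2 * k + Suc (2 * c)) R = moment a (k + c) (N - smult r P)"
    using moment_interleave(2)[of "k + c" "smult (- u) Q" Q] by (simp only: R_def Q') simp
  ultimately show ?thesis using that oN(3)[of c] by (simp add: r_def)
qed

text \<open>With even part \<open>Q\<close> and odd part \<open>T\<close>, odd offsets ask for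
  \<open>Q + u T = P'\<close> and even offsets for \<open>u Q + t T\<close> to be a multiple of
  \<open>P\<close>. Eliminating \<open>T\<close> gives \<open>t P' - r P = (t - u^2) Q\<close>, and
  evaluation at u^2 determines \<open>r\<close>.\<close>

lemma orth_odd_even:
  assumes P: "orth a k c P" and P': "orth a (Suc k) c P'" and nz: "poly P (u\<^sup>2) \<noteq> 0" and u: "u \<noteq> 0"
  obtains R where "orth a (Suc (2 * k)) (2 * c) R"
    "moment a (Suc (2 * k) + 2 * c) R = u * poly P' (u\<^sup>2) / poly P (u\<^sup>2) * moment a (k + c) P"
proof -
  note oP = orthD[OF P] and oP' = orthD[OF P']
  define r where "r = u\<^sup>2 * poly P' (u\<^sup>2) / poly P (u\<^sup>2)"
  obtain Q where Q: "pCons 0 P' - smult r P = pCons 0 Q - smult (u\<^sup>2) Q" "coeff Q c = 1" "degree Q \<le> c"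
  proof (rule monic_root_quotient)
    show "coeff (pCons 0 P' - smult r P) (Suc c) = 1" using oP(2) oP'(1) by (simp add: coeff_eq_0)
    show "degree (pCons 0 P' - smult r P) \<le> Suc c"
      using oP(2) oP'(2)
      by (intro degree_diff_le order.trans[OF degree_smult_le] order.trans[OF degree_pCons_le]) auto
    show "poly (pCons 0 P' - smult r P) (u\<^sup>2) = 0" using nz by (simp add: r_def)
  qed
  define T where "T = smult (1 / u) (P' - Q)"
  have T1: "Q + smult u T = P'" using u by (simp add: T_def)
  have T2: "smult u Q + pCons 0 T = smult (r / u) P"
  proof -
    have "smult u (smult u Q + pCons 0 T) = smult (u\<^sup>2) Q + pCons 0 (P' - Q)"
      using u by (simp add: T_def smult_add_right power2_eq_square)
    also have "\<dots> = smult (u\<^sup>2) Q + (pCons 0 P' - pCons 0 Q)" by simp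
    also have "\<dots> = smult r P"
    proof -
      have "C - y = B - x \<Longrightarrow> x + (C - B) = y" for x y B C :: "'a poly"
        by algebra
      then show ?thesis using Q(1) by blast
    qed
    also have "\<dots> = smult u (smult (r / u) P)" using u by simp
    finally show ?thesis using u by (simp only: smult_cancel)
  qed
  \<comment> \<open>Both \<open>P'\<close> and \<open>Q\<close> are monic of degree
    \<open>c\<close>, so their leading terms cancel.\<close>
  have cT: "coeff T i = 0" if "i \<ge> c" for i
    using that Q(2,3) oP'(1,2) by (cases "i = c") (auto simp: T_def coeff_eq_0)
  define R where "R = interleave Q T"
  have "orth a (Suc (2 * k)) (2 * c) R" unfolding R_def
  proof (rule orth_interleave_oddI)
    show "degree (interleave Q T) \<le> 2 * c"
      using Q(3) by (intro degree_interleave_le) (auto intro: coeff_eq_0 cT)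
    show "moment a (k + i) (smult u Q + pCons 0 T) = 0" if "2 * i < 2 * c" for i
      unfolding T2 using that oP(3) by simp
    show "moment a (Suc k + i) (Q + smult u T) = 0" if "Suc (2 * i) < 2 * c" for i
      unfolding T1 using that oP'(3)[of i] by simp
  qed (use Q(2) in \<open>auto simp: coeff_interleave\<close>)
  moreover have "moment a (Suc (2 * k) + 2 * c) R = moment a (k + c) (smult (r / u) P)"
    using moment_interleave(2)[of "k + c" Q T] by (simp only: R_def T2) simp
  ultimately show ?thesis using that u by (simp add: r_def power2_eq_square)
qed

text \<open>Now even offsets ask for \<open>u T + t Q = N\<close> and odd offsets for
  \<open>T + u Q\<close> to be a multiple of \<open>P'\<close>. Eliminating \<open>T\<close> gives
  \<open>N - r P' = (t - u^2) Q\<close>, which again fixes \<open>r\<close> at u^2.\<close>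

lemma orth_odd_odd:
  assumes P': "orth a (Suc k) c P'" and N: "orth a k (Suc c) N" and nz: "poly P' (u\<^sup>2) \<noteq> 0"
    and u: "u \<noteq> 0"
  obtains R where "orth a (Suc (2 * k)) (Suc (2 * c)) R"
    "moment a (Suc (2 * k) + Suc (2 * c)) R =
       poly N (u\<^sup>2) / poly P' (u\<^sup>2) * moment a (Suc k + c) P' / u"
proof -
  note oN = orthD[OF N] and oP' = orthD[OF P']
  define r where "r = poly N (u\<^sup>2) / poly P' (u\<^sup>2)"
  obtain Q where Q: "N - smult r P' = pCons 0 Q - smult (u\<^sup>2) Q" "coeff Q c = 1" "degree Q \<le> c"
  proof (rule monic_root_quotient)
    show "coeff (N - smult r P') (Suc c) = 1" using oP'(2) oN(1) by (simp add: coeff_eq_0)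
    show "degree (N - smult r P') \<le> Suc c"
      using oP'(2) oN(2) by (intro degree_diff_le order.trans[OF degree_smult_le]) auto
    show "poly (N - smult r P') (u\<^sup>2) = 0" using nz by (simp add: r_def)
  qed
  define T where "T = smult (1 / u) (N - pCons 0 Q)"
  have T1: "smult u T + pCons 0 Q = N" using u by (simp add: T_def)
  have T2: "T + smult u Q = smult (r / u) P'"
  proof -
    have "smult u (T + smult u Q) = N - pCons 0 Q + smult (u\<^sup>2) Q"
      using u by (simp add: T_def smult_add_right power2_eq_square)
    also have "\<dots> = smult u (smult (r / u) P')" using Q(1) u by (simp add: algebra_simps)
    finally show ?thesis using u by (simp only: smult_cancel)
  qed
  have cT: "coeff T i = 0" if "i > c" for i
    using that Q(2,3) oN(1,2)
    by (cases "i = Suc c") (auto simp: T_def coeff_eq_0 coeff_pCons split: nat.splits)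
  define R where "R = interleave T Q"
  have "orth a (Suc (2 * k)) (Suc (2 * c)) R" unfolding R_def
  proof (rule orth_interleave_oddI)
    show "degree (interleave T Q) \<le> Suc (2 * c)"
      using Q(3) by (intro degree_interleave_le) (auto intro: coeff_eq_0 cT)
    show "moment a (k + i) (smult u T + pCons 0 Q) = 0" if "2 * i < Suc (2 * c)" for i
      unfolding T1 using that oN(3) by simp
    show "moment a (Suc k + i) (T + smult u Q) = 0" if "Suc (2 * i) < Suc (2 * c)" for i
      unfolding T2 using that oP'(3)[of i] by simp
  qed (use Q(2) in \<open>auto simp: coeff_interleave\<close>)
  moreover have "moment a (Suc (2 * k) + Suc (2 * c)) R = moment a (Suc k + c) (smult (r / u) P')"
    using moment_interleave(1)[of "Suc k + c" T Q] by (simp only: R_def T2) simp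
  ultimately show ?thesis using that by (simp add: r_def)
qed

end

section \<open>Valuations of the norms\<close>

text \<open>The p-adic valuation as a relation. For prime \<open>p\<close>, zero has no valuation,
  so every such statement includes nonvanishing.\<close>

definition has_val :: "int \<Rightarrow> rat \<Rightarrow> int \<Rightarrow> bool" where
  "has_val p x n \<longleftrightarrow> (\<exists>b c. \<not> p dvd b \<and> \<not> p dvd c \<and> x = of_int b / of_int c * of_int p powi n)"

context
  fixes p :: int
  assumes p: "prime p"
begin

lemma has_val_nonzero: "has_val p x n \<Longrightarrow> x \<noteq> 0"
  using p by (auto simp: has_val_def)

lemma has_val_1: "has_val p 1 0"
  unfolding has_val_def using p by (intro exI[of _ 1]) (auto simp: not_prime_unit)

lemma has_val_mult:
  assumes "has_val p x m" "has_val p y n"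
  shows "has_val p (x * y) (m + n)"
proof -
  obtain b c where x: "\<not> p dvd b" "\<not> p dvd c" "x = of_int b / of_int c * of_int p powi m"
    using assms(1) by (auto simp: has_val_def)
  obtain d e where y: "\<not> p dvd d" "\<not> p dvd e" "y = of_int d / of_int e * of_int p powi n"
    using assms(2) by (auto simp: has_val_def)
  have "\<not> p dvd b * d" "\<not> p dvd c * e" using x y p by (auto simp: prime_dvd_mult_iff)
  moreover have "x * y = of_int (b * d) / of_int (c * e) * of_int p powi (m + n)"
    using p by (simp add: x y power_int_add)
  ultimately show ?thesis unfolding has_val_def by blast
qed

lemma has_val_inverse:
  assumes "has_val p x m"
  shows "has_val p (inverse x) (- m)"
proof -
  obtain b c where x: "\<not> p dvd b" "\<not> p dvd c" "x = of_int b / of_int c * of_int p powi m"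
    using assms by (auto simp: has_val_def)
  have "inverse x = of_int c / of_int b * of_int p powi (- m)"
    using p by (simp add: x power_int_minus divide_inverse)
  then show ?thesis unfolding has_val_def using x by blast
qed

lemma has_val_divide: "has_val p x m \<Longrightarrow> has_val p y n \<Longrightarrow> has_val p (x / y) (m - n)"
  using has_val_mult[OF _ has_val_inverse, of x m y n] by (simp add: field_simps)

lemma has_val_uminus:
  assumes "has_val p x m"
  shows "has_val p (- x) m"
proof -
  obtain b c where x: "\<not> p dvd b" "\<not> p dvd c" "x = of_int b / of_int c * of_int p powi m"
    using assms by (auto simp: has_val_def)
  then have "\<not> p dvd - b" "- x = of_int (- b) / of_int c * of_int p powi m" by simp_all
  with x show ?thesis unfolding has_val_def by blast
qed

lemma has_val_add_less:
  assumes "has_val p x m" "has_val p y n" "m < n"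
  shows "has_val p (x + y) m"
proof -
  obtain b c where x: "\<not> p dvd b" "\<not> p dvd c" "x = of_int b / of_int c * of_int p powi m"
    using assms(1) by (auto simp: has_val_def)
  obtain d e where y: "\<not> p dvd d" "\<not> p dvd e" "y = of_int d / of_int e * of_int p powi n"
    using assms(2) by (auto simp: has_val_def)
  define j where "j = nat (n - m)"
  have j: "n = m + int j" "j > 0" using assms(3) by (auto simp: j_def)
  have nz: "c \<noteq> 0" "e \<noteq> 0" "p \<noteq> 0" using x y p by auto
  have "\<not> p dvd b * e" using x y p by (auto simp: prime_dvd_mult_iff)
  moreover have "p dvd d * c * p ^ j" using j by simp
  ultimately have "\<not> p dvd b * e + d * c * p ^ j"
    using dvd_add_left_iff by blast
  moreover have "\<not> p dvd c * e" using x y p by (auto simp: prime_dvd_mult_iff)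
  moreover have "x + y = of_int (b * e + d * c * p ^ j) / of_int (c * e) * of_int p powi m"
    using nz by (simp add: x y j(1) power_int_add field_simps)
  ultimately show ?thesis unfolding has_val_def by blast
qed

lemma has_val_diff:
  assumes "has_val p x m" "has_val p y n" "m \<noteq> n"
  shows "has_val p (x - y) (min m n)"
proof (cases "m < n")
  case True
  then show ?thesis using has_val_add_less[OF assms(1) has_val_uminus[OF assms(2)]] by simp
next
  case False
  then show ?thesis
    using has_val_add_less[OF has_val_uminus[OF assms(2)] assms(1)] assms(3) by (simp add: min_def)
qed

end

text \<open>In lowest terms the numerator or the denominator of \<open>u\<close> is not a unit; a
  prime factor of one does not divide the other.\<close>

lemma has_val_exists:
  fixes u :: rat
  assumes "u \<notin> {-1, 0, 1}"
  obtains p w where "prime p" "has_val p u w" "w \<noteq> 0"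
proof -
  obtain b c where bc: "quotient_of u = (b, c)" by (cases "quotient_of u")
  then have u: "u = of_int b / of_int c" and c: "c > 0" and cop: "coprime b c"
    by (auto simp: quotient_of_div quotient_of_denom_pos quotient_of_coprime)
  have b: "b \<noteq> 0" using u assms by auto
  have *: "\<exists>p::int. prime p \<and> p dvd x" if "\<bar>x\<bar> \<noteq> 1" for x :: int
    using that prime_factor_int by blast
  have "\<bar>b\<bar> \<noteq> 1 \<or> \<bar>c\<bar> \<noteq> 1"
  proof (rule ccontr)
    assume "\<not> ?thesis"
    then have "c = 1" "b = 1 \<or> b = -1" using c by auto
    then show False using u assms by auto
  qed
  then obtain p :: int where p: "prime p" "p dvd b \<or> p dvd c"
    using * by blast
  obtain b' where b': "b = p ^ multiplicity p b * b'" "\<not> p dvd b'"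
    using multiplicity_decompose'[of b p] b p by (metis not_prime_unit)
  obtain c' where c': "c = p ^ multiplicity p c * c'" "\<not> p dvd c'"
    using multiplicity_decompose'[of c p] c p by (metis not_prime_unit less_irrefl)
  let ?w = "int (multiplicity p b) - int (multiplicity p c)"
  have "(of_int b :: rat) = of_int p ^ multiplicity p b * of_int b'"
    "(of_int c :: rat) = of_int p ^ multiplicity p c * of_int c'"
    by (metis b'(1) of_int_mult of_int_power, metis c'(1) of_int_mult of_int_power)
  then have "u = of_int b' / of_int c' * of_int p powi ?w"
    using p u by (simp add: power_int_diff field_simps)
  then have "has_val p u ?w" unfolding has_val_def using b' c' by blast
  moreover have "?w \<noteq> 0"
  proof -
    have "\<not> (p dvd b \<and> p dvd c)"
      using cop p(1) coprime_common_divisor not_prime_unit by blast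
    then have "multiplicity p b > 0 \<and> multiplicity p c = 0 \<or> multiplicity p b = 0 \<and> multiplicity p c > 0"
      using p b c prime_multiplicity_gt_zero_iff[of p b] prime_multiplicity_gt_zero_iff[of p c]
      by (metis gr0I less_irrefl prime_imp_prime_elem prime_multiplicity_gt_zero_iff)
    then show ?thesis by auto
  qed
  ultimately show ?thesis using that p by blast
qed

section \<open>Inductive computation of the valuations\<close>

text \<open>
  \<open>V k n\<close> is the valuation of the Hankel determinant \<open>D\<close> of size \<open>n\<close> starting at \<open>a\<^sub>k\<close>, and \<open>W k n\<close>
  that of \<open>D P\<^bsub>k,n\<^esub>(u\<^sup>2)\<close>.
\<close>

locale padic_mahler_seq = mahler_seq a u for a :: "nat \<Rightarrow> rat" and u +
  fixes p w :: int and V W :: "nat \<Rightarrow> nat \<Rightarrow> int"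
  assumes p: "prime p" and u: "has_val p u w" and a0: "a 0 = 1"
    and V_zero: "V k 0 = 0" and W_zero: "W k 0 = 0" and V_start: "V 0 (Suc 0) = 0"
    and V_even_even: "V (2 * k) (2 * c) = V k c + W k c"
    and V_even_odd: "V (2 * k) (Suc (2 * c)) = V k (Suc c) + W k c"
    and V_odd_even: "V (Suc (2 * k)) (2 * c) = W k c + V (Suc k) c"
    and V_odd_odd: "V (Suc (2 * k)) (Suc (2 * c)) = w + V k (Suc c) + W (Suc k) c"
    and dominance: "W k n + V (Suc k) (Suc n) \<noteq> 2 * w + V k (Suc n) + W (Suc k) n"
    and W_step: "W k (Suc n) + V (Suc k) n =
       min (W k n + V (Suc k) (Suc n)) (2 * w + V k (Suc n) + W (Suc k) n)"
begin

lemmas val_intros = has_val_mult[OF p] has_val_divide[OF p] has_val_uminus[OF p]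

text \<open>This is the case of degree 0, where the orthogonal polynomial is 1 and its norm is
  \<open>a k\<close>.\<close>

lemma has_val_seq: "has_val p (a k) (V k (Suc 0))"
proof (induction k rule: less_induct)
  case (less k)
  show ?case
  proof (cases "k = 0")
    case True
    then show ?thesis using a0 V_start has_val_1[OF p] by simp
  next
    case False
    then have IH: "has_val p (a (k div 2)) (V (k div 2) (Suc 0))" using less by simp
    show ?thesis
    proof (cases "even k")
      case True
      then obtain m where "k = 2 * m" by blast
      then show ?thesis using IH a_even[of m] V_even_odd[of m 0] W_zero by simp
    next
      case False
      then obtain m where "k = Suc (2 * m)" by (metis oddE Suc_eq_plus1)
      then show ?thesis
        using has_val_mult[OF p u IH] a_odd[of m] V_odd_odd[of m 0] W_zero by simp
    qed
  qed
qed

definition val_orth :: "nat \<Rightarrow> nat \<Rightarrow> rat poly \<Rightarrow> bool" where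
  "val_orth k n P \<longleftrightarrow> orth a k n P \<and> has_val p (poly P (u\<^sup>2)) (W k n - V k n)"

text \<open>The norm is the quotient of the Hankel determinants of sizes \<open>Suc n\<close> and
  \<open>n\<close>, hence the difference.\<close>

definition val_norm :: "nat \<Rightarrow> nat \<Rightarrow> rat poly \<Rightarrow> bool" where
  "val_norm k n P \<longleftrightarrow> has_val p (moment a (k + n) P) (V k (Suc n) - V k n)"

text \<open>The recurrence of \<open>orth_step\<close> is evaluated at u^2. By
  \<open>dominance\<close> its two terms have different valuations, so no cancellation occurs;
  \<open>W_step\<close> is the result with the determinants cleared.\<close>

lemma val_orth_Suc:
  assumes "val_orth k n P" "val_norm k n P" "val_orth (Suc k) n P'" "val_norm (Suc k) n P'"
  shows "\<exists>N. val_orth k (Suc n) N"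
proof -
  define r where "r = moment a (Suc k + n) P' / moment a (k + n) P"
  define N where "N = pCons 0 P' - smult r P"
  have nz: "moment a (k + n) P \<noteq> 0"
    using assms(2) has_val_nonzero[OF p] by (auto simp: val_norm_def)
  have "orth a k (Suc n) N"
    unfolding N_def r_def using assms orth_step nz by (auto simp: val_orth_def)
  moreover have "has_val p (poly N (u\<^sup>2)) (W k (Suc n) - V k (Suc n))"
  proof -
    have 1: "has_val p (u * u * poly P' (u\<^sup>2)) (w + w + (W (Suc k) n - V (Suc k) n))"
      using assms by (intro val_intros u) (simp add: val_orth_def)
    have 2: "has_val p (r * poly P (u\<^sup>2))
       (V (Suc k) (Suc n) - V (Suc k) n - (V k (Suc n) - V k n) + (W k n - V k n))"
      unfolding r_def using assms by (intro val_intros) (simp_all add: val_orth_def val_norm_def)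
    have "has_val p (u * u * poly P' (u\<^sup>2) - r * poly P (u\<^sup>2))
        (min (w + w + (W (Suc k) n - V (Suc k) n))
          (V (Suc k) (Suc n) - V (Suc k) n - (V k (Suc n) - V k n) + (W k n - V k n)))"
      using dominance[of k n] by (intro has_val_diff[OF p 1 2]) simp
    moreover have "min (w + w + (W (Suc k) n - V (Suc k) n))
          (V (Suc k) (Suc n) - V (Suc k) n - (V k (Suc n) - V k n) + (W k n - V k n)) =
        W k (Suc n) - V k (Suc n)"
      using W_step[of k n] by (simp add: min_def split: if_splits)
    ultimately show ?thesis by (simp add: N_def power2_eq_square)
  qed
  ultimately show ?thesis by (auto simp: val_orth_def)
qed

lemma val_norm_halving:
  assumes n: "n > 0"
    and IH: "\<And>m k. m < n \<Longrightarrow> \<exists>P. val_orth k m P \<and> val_norm k m P"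
    and orth: "\<And>k. \<exists>P. val_orth k n P"
  shows "\<exists>R. orth a k n R \<and> val_norm k n R"
proof -
  define c where "c = n div 2"
  define m where "m = k div 2"
  have "c < n" using n by (simp add: c_def)
  obtain P where P: "val_orth m c P" "val_norm m c P" using IH[OF \<open>c < n\<close>] by blast
  obtain P' where P': "val_orth (Suc m) c P'" "val_norm (Suc m) c P'" using IH[OF \<open>c < n\<close>] by blast
  note defs = val_orth_def val_norm_def
  have nz: "poly P (u\<^sup>2) \<noteq> 0" "poly P' (u\<^sup>2) \<noteq> 0" "u \<noteq> 0"
    using P P' u has_val_nonzero[OF p] by (auto simp: val_orth_def)
  \<comment> \<open>For \<open>n = 1\<close> one has \<open>Suc c = n\<close>, beyond the reach of
    \<open>IH\<close>; this is why \<open>orth\<close> is assumed at size \<open>n\<close>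
    itself.\<close>
  have N: "\<exists>N. val_orth m (Suc c) N" if "n = Suc (2 * c)"
    using that IH[of "Suc c" m] orth[of m] by (cases "Suc c = n") auto
  have "k = 2 * m \<or> k = Suc (2 * m)" "n = 2 * c \<or> n = Suc (2 * c)"
    unfolding c_def m_def by presburger+
  then consider "k = 2 * m" "n = 2 * c" | "k = 2 * m" "n = Suc (2 * c)"
    | "k = Suc (2 * m)" "n = 2 * c" | "k = Suc (2 * m)" "n = Suc (2 * c)"
    by blast
  then show ?thesis
  proof cases
    case 1
    then show ?thesis
      using orth_even_even[of m c P] P V_even_odd[of m c] V_even_even[of m c]
      by (intro exI[of _ "interleave P 0"]) (auto simp: defs)
  next
    case 2
    obtain N where N: "val_orth m (Suc c) N" using N 2 by blast
    obtain R where R: "orth a (2 * m) (Suc (2 * c)) R"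
      "moment a (2 * m + Suc (2 * c)) R = - (poly N (u\<^sup>2) / poly P (u\<^sup>2) * moment a (m + c) P)"
      using orth_even_odd[of m c P N] P N nz by (auto simp: val_orth_def)
    have "has_val p (- (poly N (u\<^sup>2) / poly P (u\<^sup>2) * moment a (m + c) P))
      (W m (Suc c) - V m (Suc c) - (W m c - V m c) + (V m (Suc c) - V m c))"
      using P N by (intro val_intros) (simp_all add: defs)
    then show ?thesis
      using 2 R V_even_odd[of m c] V_even_even[of m "Suc c"] by (intro exI[of _ R]) (simp add: defs)
  next
    case 3
    obtain R where R: "orth a (Suc (2 * m)) (2 * c) R"
      "moment a (Suc (2 * m) + 2 * c) R = u * poly P' (u\<^sup>2) / poly P (u\<^sup>2) * moment a (m + c) P"
      using orth_odd_even[of m c P P'] P P' nz by (auto simp: val_orth_def)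
    have "has_val p (u * poly P' (u\<^sup>2) / poly P (u\<^sup>2) * moment a (m + c) P)
      (w + (W (Suc m) c - V (Suc m) c) - (W m c - V m c) + (V m (Suc c) - V m c))"
      using P P' by (intro val_intros u) (simp_all add: defs)
    then show ?thesis
      using 3 R V_odd_even[of m c] V_odd_odd[of m c]
      by (intro exI[of _ R]) (simp add: defs algebra_simps)
  next
    case 4
    obtain N where N: "val_orth m (Suc c) N" using N 4 by blast
    obtain R where R: "orth a (Suc (2 * m)) (Suc (2 * c)) R"
      "moment a (Suc (2 * m) + Suc (2 * c)) R = poly N (u\<^sup>2) / poly P' (u\<^sup>2) * moment a (Suc m + c) P' / u"
      using orth_odd_odd[of m c P' N] P' N nz by (auto simp: val_orth_def)
    have "has_val p (poly N (u\<^sup>2) / poly P' (u\<^sup>2) * moment a (Suc m + c) P' / u)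
      (W m (Suc c) - V m (Suc c) - (W (Suc m) c - V (Suc m) c) + (V (Suc m) (Suc c) - V (Suc m) c) - w)"
      using P' N by (intro val_intros u) (simp_all add: defs)
    then show ?thesis
      using 4 R V_odd_even[of m "Suc c"] V_odd_odd[of m c]
      by (intro exI[of _ R]) (simp add: defs algebra_simps)
  qed
qed

text \<open>At each size the recurrence first gives a polynomial with known value at u^2. Halving
  then gives one with known norm, and uniqueness of the norm joins the two.\<close>

lemma val_orth_norm: "\<exists>P. val_orth k n P \<and> val_norm k n P"
proof (induction n arbitrary: k rule: less_induct)
  case (less n)
  show ?case
  proof (cases n)
    case 0
    then show ?thesis
      using has_val_seq[of k] has_val_1[OF p] V_zero W_zero
      by (intro exI[of _ 1]) (simp add: val_orth_def val_norm_def orth_def)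
  next
    case (Suc m)
    have orth: "\<exists>P. val_orth k n P" for k
      using less[of m k] less[of m "Suc k"] val_orth_Suc Suc by blast
    obtain R where "orth a k n R" "val_norm k n R"
      using val_norm_halving[of n k] less orth Suc by blast
    moreover obtain P where "val_orth k n P" using orth by blast
    ultimately show ?thesis
      using orth_norm_unique[of a k n P R] by (auto simp: val_orth_def val_norm_def)
  qed
qed

lemma nondegenerate:
  assumes "q \<noteq> 0"
  shows "\<exists>i\<le>degree q. moment a (k + i) q \<noteq> 0"
proof -
  obtain P where "val_orth k (degree q) P" "val_norm k (degree q) P" using val_orth_norm by blast
  then show ?thesis
    using orth_nondegenerate[of a k q P] has_val_nonzero[OF p] assms
    by (auto simp: val_orth_def val_norm_def)
qed

end

section \<open>Explicit valuations of the Hankel determinants\<close>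

text \<open>
  The order at \<open>u = 0\<close> and (\<open>tau_max\<close> below) the degree in \<open>u\<close> of the Hankel determinant of size
  \<open>n\<close> starting at \<open>a\<^sub>k\<close>, i.e. the extrema of \<open>\<Sum>\<^sub>i s(k + i + \<sigma>(i))\<close> over permutations \<open>\<sigma>\<close>.
\<close>

function tau_min :: "nat \<Rightarrow> nat \<Rightarrow> int" where
  "tau_min k n =
    (if n = 0 \<or> k = 0 \<and> n = 1 then 0
     else if even k then tau_min (k div 2) (n - n div 2) + tau_min (Suc (k div 2)) (n div 2)
     else if even n then 2 * tau_min (Suc (k div 2)) (n div 2)
     else 1 + tau_min (k div 2) (Suc (n div 2)) + tau_min (Suc (Suc (k div 2))) (n div 2))"
  by auto
text \<open>The weight 2 is there because \<open>k + n\<close> does not decrease from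
  \<open>(0, 2)\<close> to \<open>(1, 1)\<close>. The pair \<open>(0, 1)\<close> would call itself,
  hence its place in the base case.\<close>

termination by (relation "Wellfounded.measure (\<lambda>(k, n). k + 2 * n)") (simp; presburger)+

declare tau_min.simps [simp del]

lemma tau_min_zero [simp]: "tau_min k 0 = 0"
  by (simp add: tau_min.simps)

lemma tau_min_start [simp]: "tau_min 0 (Suc 0) = 0"
  by (simp add: tau_min.simps)

lemma tau_min_even_even: "tau_min (2 * k) (2 * c) = tau_min k c + tau_min (Suc k) c"
  by (cases "c = 0") (simp_all add: tau_min.simps[of "2 * k" "2 * c"])

lemma tau_min_even_odd: "tau_min (2 * k) (Suc (2 * c)) = tau_min k (Suc c) + tau_min (Suc k) c"
  by (cases "k = 0 \<and> c = 0") (auto simp: tau_min.simps[of "2 * k" "Suc (2 * c)"] Suc_diff_le)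

lemma tau_min_odd_even: "tau_min (Suc (2 * k)) (2 * c) = 2 * tau_min (Suc k) c"
  by (cases "c = 0") (simp_all add: tau_min.simps[of "Suc (2 * k)" "2 * c"])

lemma tau_min_odd_odd: "tau_min (Suc (2 * k)) (Suc (2 * c)) = 1 + tau_min k (Suc c) + tau_min (Suc (Suc k)) c"
  by (simp add: tau_min.simps[of "Suc (2 * k)" "Suc (2 * c)"])

lemmas tau_min_rec = tau_min_even_even tau_min_even_odd tau_min_odd_even tau_min_odd_odd

text \<open>For even \<open>k\<close> both sides agree. For odd \<open>k\<close> the inequality
  reduces to an instance at halved arguments with 1 to spare.\<close>

lemma tau_min_ineq: "tau_min (Suc k) n + tau_min (Suc k) (Suc n) \<le> 1 + tau_min k (Suc n) + tau_min (Suc (Suc k)) n"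
proof (induction "k + n" arbitrary: k n rule: less_induct)
  case less
  define m where "m = k div 2"
  define c where "c = n div 2"
  have "k = 2 * m \<or> k = Suc (2 * m)" "n = 2 * c \<or> n = Suc (2 * c)"
    unfolding c_def m_def by presburger+
  then consider "k = 2 * m" "n = 2 * c" | "k = 2 * m" "n = Suc (2 * c)"
    | "k = Suc (2 * m)" "n = 2 * c" | "k = Suc (2 * m)" "n = Suc (2 * c)"
    by blast
  then show ?case
  proof cases
    case 1
    then show ?thesis using tau_min_rec[of m c] tau_min_even_even[of "Suc m" c] by simp
  next
    case 2
    then show ?thesis
      using tau_min_odd_odd[of m c] tau_min_odd_even[of m "Suc c"] tau_min_even_even[of m "Suc c"]
        tau_min_even_odd[of "Suc m" c] by simp
  next
    case 3
    then show ?thesis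
      using less[of m c] tau_min_even_even[of "Suc m" c] tau_min_even_odd[of "Suc m" c] tau_min_odd_odd[of m c]
        tau_min_odd_even[of "Suc m" c] by simp
  next
    case 4
    then show ?thesis
      using less[of "Suc m" c] tau_min_even_odd[of "Suc m" c] tau_min_even_even[of "Suc m" "Suc c"]
        tau_min_odd_even[of m "Suc c"] tau_min_odd_odd[of "Suc m" c] by simp
  qed
qed

function tau_max :: "nat \<Rightarrow> nat \<Rightarrow> int" where
  "tau_max k n =
    (if n = 0 \<or> k = 0 \<and> n = 1 then 0
     else int (k mod 2 * (n mod 2)) + 2 * int (n div 2)
       + tau_max (k div 2) (n - n div 2) + tau_max (Suc k div 2) (n div 2))"
  by auto
termination by (relation "Wellfounded.measure (\<lambda>(k, n). k + 2 * n)") (simp; presburger)+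

declare tau_max.simps [simp del]

lemma tau_max_zero [simp]: "tau_max k 0 = 0"
  by (simp add: tau_max.simps)

lemma tau_max_start [simp]: "tau_max 0 (Suc 0) = 0"
  by (simp add: tau_max.simps)

lemma tau_max_even_even: "tau_max (2 * k) (2 * c) = 2 * int c + 2 * tau_max k c"
  by (cases "c = 0") (simp_all add: tau_max.simps[of "2 * k" "2 * c"])

lemma tau_max_even_odd: "tau_max (2 * k) (Suc (2 * c)) = 2 * int c + tau_max k (Suc c) + tau_max k c"
  by (cases "k = 0 \<and> c = 0") (auto simp: tau_max.simps[of "2 * k" "Suc (2 * c)"] Suc_diff_le)

lemma tau_max_odd_even: "tau_max (Suc (2 * k)) (2 * c) = 2 * int c + tau_max k c + tau_max (Suc k) c"
  by (cases "c = 0") (simp_all add: tau_max.simps[of "Suc (2 * k)" "2 * c"])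

lemma tau_max_odd_odd:
  "tau_max (Suc (2 * k)) (Suc (2 * c)) = 1 + 2 * int c + tau_max k (Suc c) + tau_max (Suc k) c"
  by (simp add: tau_max.simps[of "Suc (2 * k)" "Suc (2 * c)"] Suc_diff_le)

lemmas tau_max_rec = tau_max_even_even tau_max_even_odd tau_max_odd_even tau_max_odd_odd

text \<open>Both sides agree if \<open>k\<close> and \<open>n\<close> have equal parity; otherwise
  the instance at \<open>(k div 2, n div 2)\<close> suffices with 1 to spare.\<close>

lemma tau_max_ineq: "tau_max k n + tau_max (Suc k) (Suc n) \<le> 1 + tau_max k (Suc n) + tau_max (Suc k) n"
proof (induction "k + n" arbitrary: k n rule: less_induct)
  case less
  define m where "m = k div 2"
  define c where "c = n div 2"
  have "k = 2 * m \<or> k = Suc (2 * m)" "n = 2 * c \<or> n = Suc (2 * c)"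
    unfolding c_def m_def by presburger+
  then consider "k = 2 * m" "n = 2 * c" | "k = 2 * m" "n = Suc (2 * c)"
    | "k = Suc (2 * m)" "n = 2 * c" | "k = Suc (2 * m)" "n = Suc (2 * c)"
    by blast
  then show ?case
  proof cases
    case 1
    then show ?thesis using tau_max_rec[of m c] by simp
  next
    case 2
    then show ?thesis
      using less[of m c] tau_max_rec[of m c] tau_max_rec[of m "Suc c"] by simp
  next
    case 3
    then show ?thesis
      using less[of m c] tau_max_rec[of m c] tau_max_rec[of "Suc m" c] by simp
  next
    case 4
    then show ?thesis
      using tau_max_rec[of m c] tau_max_rec[of m "Suc c"] tau_max_rec[of "Suc m" c] tau_max_rec[of "Suc m" "Suc c"]
      by simp
  qed
qed

lemma mahler_seq_nondegenerate:
  fixes u :: rat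
  assumes seq: "mahler_seq a u" "a 0 = 1" and u: "u \<notin> {-1, 0, 1}" and q: "q \<noteq> 0"
  shows "\<exists>i\<le>degree q. moment a (k + i) q \<noteq> 0"
proof -
  interpret mahler_seq a u by fact
  obtain p w where p: "prime p" "has_val p u w" "w \<noteq> 0" using has_val_exists[OF u] by blast
  show ?thesis
  proof (cases "w > 0")
    case True
    have strict: "w * tau_min (Suc k) n + w * tau_min (Suc k) (Suc n)
        < 2 * w + w * tau_min k (Suc n) + w * tau_min (Suc (Suc k)) n" for k n
      using mult_strict_left_mono[of "tau_min (Suc k) n + tau_min (Suc k) (Suc n)"
          "2 + tau_min k (Suc n) + tau_min (Suc (Suc k)) n" w] tau_min_ineq[of k n] True
      by (simp add: algebra_simps)
    \<comment> \<open>For \<open>w > 0\<close> the value at u^2 has the valuation of the constant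
      term, and D times P(0) is, up to sign, the determinant starting at \<open>Suc k\<close>. The
      subtracted term of the recurrence dominates.\<close>
    interpret padic_mahler_seq a u p w "\<lambda>k n. w * tau_min k n" "\<lambda>k n. w * tau_min (Suc k) n"
    proof
      show "w * tau_min (Suc k) n + w * tau_min (Suc k) (Suc n)
          \<noteq> 2 * w + w * tau_min k (Suc n) + w * tau_min (Suc (Suc k)) n" for k n
        using strict[of k n] by simp
      show "w * tau_min (Suc k) (Suc n) + w * tau_min (Suc k) n =
        min (w * tau_min (Suc k) n + w * tau_min (Suc k) (Suc n))
            (2 * w + w * tau_min k (Suc n) + w * tau_min (Suc (Suc k)) n)" for k n
        using strict[of k n] by simp
    qed (use p seq in \<open>simp_all add: tau_min_rec distrib_left\<close>)
    show ?thesis by (rule nondegenerate[OF q])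
  next
    case False
    then have w: "w < 0" using p by simp
    have strict: "w * (2 * int n + tau_max k n) + w * tau_max (Suc k) (Suc n)
        > 2 * w + w * tau_max k (Suc n) + w * (2 * int n + tau_max (Suc k) n)" for k n
      using mult_strict_left_mono_neg[of "tau_max k n + tau_max (Suc k) (Suc n)"
          "2 + tau_max k (Suc n) + tau_max (Suc k) n" w] tau_max_ineq[of k n] w
      by (simp add: algebra_simps)
    \<comment> \<open>For \<open>w < 0\<close> the value at u^2 has the valuation
      \<open>2 * n * w\<close> of its leading term, and the term with factor u^2 dominates.\<close>
    interpret padic_mahler_seq a u p w "\<lambda>k n. w * tau_max k n" "\<lambda>k n. w * (2 * int n + tau_max k n)"
    proof
      show "w * (2 * int n + tau_max k n) + w * tau_max (Suc k) (Suc n)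
          \<noteq> 2 * w + w * tau_max k (Suc n) + w * (2 * int n + tau_max (Suc k) n)" for k n
        using strict[of k n] by simp
      show "w * (2 * int (Suc n) + tau_max k (Suc n)) + w * tau_max (Suc k) n =
        min (w * (2 * int n + tau_max k n) + w * tau_max (Suc k) (Suc n))
            (2 * w + w * tau_max k (Suc n) + w * (2 * int n + tau_max (Suc k) n))" for k n
        using strict[of k n] by (simp add: min_def algebra_simps)
    qed (use p seq in \<open>simp_all add: tau_max_rec distrib_left\<close>)
    show ?thesis by (rule nondegenerate[OF q])
  qed
qed

section \<open>Approximation of the Mahler series\<close>

lemma mahler_seq_mahler_limit: "mahler_seq (fps_nth (mahler_limit u)) u"
proof
  fix m
  have eq: "mahler_limit u $ n = (mahler_limit u oo fps_X ^ 2) $ n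
      + u * (if n = 0 then 0 else (mahler_limit u oo fps_X ^ 2) $ (n - 1))" for n
    by (subst mahler_limit_functional) (simp add: distrib_right mult.assoc)
  show "mahler_limit u $ (2 * m) = mahler_limit u $ m"
    by (subst eq) (auto simp: fps_nth_compose_X_power)
  show "mahler_limit u $ (Suc (2 * m)) = u * mahler_limit u $ m"
    by (subst eq) (auto simp: fps_nth_compose_X_power)
qed

lemma mahler_g_nth: "mahler_g u $$ (int n + 1) = mahler_limit u $ n"
  by (simp add: mahler_g_eq fls_X_times_conv_shift)

lemma ls_of_poly_pCons: "ls_of_poly (pCons c q) = fls_const c + fls_X_inv * ls_of_poly q"
  by (simp add: ls_of_poly_def map_poly_pCons)

lemma ls_of_poly_0 [simp]: "ls_of_poly 0 = 0"
  by (simp add: ls_of_poly_def)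

lemma ls_of_poly_1 [simp]: "ls_of_poly 1 = 1"
  by (simp add: one_pCons ls_of_poly_pCons)

lemma ls_of_poly_add: "ls_of_poly (p + q) = ls_of_poly p + ls_of_poly q"
  by (rule fls_eqI) (simp add: ls_of_poly_nth)

lemma fls_X_inv_power_times_nth: "(fls_X_inv ^ k * f) $$ i = f $$ (i + int k)"
  by (simp add: fls_X_inv_power_times_conv_shift)

lemma ls_of_poly_times_nth:
  assumes "\<And>n. f $$ (int n + 1) = a n"
  shows "(ls_of_poly q * f) $$ (int i + 1) = moment a i q"
proof (induction q arbitrary: i)
  case 0
  then show ?case by (simp add: ls_of_poly_def)
next
  case (pCons c q)
  have "ls_of_poly (pCons c q) * f = fls_const c * f + fls_X_inv ^ 1 * (ls_of_poly q * f)"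
    by (simp add: ls_of_poly_pCons distrib_right mult.assoc)
  then have "(ls_of_poly (pCons c q) * f) $$ (int i + 1) =
      c * f $$ (int i + 1) + (ls_of_poly q * f) $$ (int i + 1 + 1)"
    by (simp only: fls_plus_nth fls_X_inv_power_times_nth) simp
  then show ?case using pCons.IH[of "Suc i"] assms[of i] by (simp add: add_ac)
qed

text \<open>Multiplication by t^k shifts the coefficients, which moves the base point of the
  moments. The fractional part thus lists the moments of \<open>q\<close> from \<open>k\<close>
  on.\<close>

lemma littlewood_term_nth:
  "(ls_of_poly q * fls_X_inv ^ k * mahler_g u) $$ (int i + 1) = moment (fps_nth (mahler_limit u)) (k + i) q"
proof -
  have "(ls_of_poly q * (fls_X_inv ^ k * mahler_g u)) $$ (int i + 1)
      = moment (\<lambda>n. mahler_limit u $ (k + n)) i q"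
  proof (rule ls_of_poly_times_nth)
    fix n
    have "int n + 1 + int k = int (k + n) + 1" by simp
    then show "(fls_X_inv ^ k * mahler_g u) $$ (int n + 1) = mahler_limit u $ (k + n)"
      by (simp only: fls_X_inv_power_times_nth mahler_g_nth)
  qed
  then show ?thesis by (simp add: moment_def mult.assoc add.assoc)
qed

text \<open>A nonzero coefficient of t^(-i-1) bounds the norm below by 2^(-degree q - 1), while |q|
  is 2^(degree q); hence the constant 1/2.\<close>

lemma littlewood_term_ge:
  assumes "q \<noteq> 0" "i \<le> degree q" "f $$ (int i + 1) \<noteq> 0"
  shows "ls_abs (ls_of_poly q) * ls_norm f \<ge> 1 / 2"
proof -
  have nz: "ls_frac f $$ (int i + 1) \<noteq> 0" using assms by (simp add: ls_frac_nth)
  then have "fls_subdegree (ls_frac f) \<le> int i + 1" by (rule fls_subdegree_leI)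
  then have "- int (Suc (degree q)) \<le> - fls_subdegree (ls_frac f)" using assms(2) by simp
  then have "(2::real) powi (- int (Suc (degree q))) \<le> 2 powi (- fls_subdegree (ls_frac f))"
    by (intro power_int_increasing) auto
  moreover have "ls_frac f \<noteq> 0" using nz by auto
  ultimately have "ls_norm f \<ge> 2 powi (- int (Suc (degree q)))"
    by (simp add: ls_norm_eq ls_abs_def)
  then have "ls_abs (ls_of_poly q) * ls_norm f \<ge> 2 ^ degree q * 2 powi (- int (Suc (degree q)))"
    unfolding ls_abs_ls_of_poly[OF assms(1)] by (rule mult_left_mono) simp
  moreover have "(2::real) ^ degree q * 2 powi (- int (Suc (degree q))) = 1 / 2"
    by (simp add: power_int_minus field_simps del: of_nat_Suc)
  ultimately show ?thesis by simp
qed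

text \<open>The vanishing coefficients are those of t^(-1) to t^(-n), so the bound gives away a
  factor 2.\<close>

lemma ls_norm_le:
  assumes "\<And>i. i < n \<Longrightarrow> f $$ (int i + 1) = 0"
  shows "ls_norm f \<le> (1 / 2) ^ n"
proof (cases "ls_frac f = 0")
  case True
  then show ?thesis by (simp add: ls_norm_eq ls_abs_def)
next
  case False
  have "ls_frac f $$ k = 0" if "k < int n" for k
    using that assms[of "nat (k - 1)"] by (auto simp: ls_frac_nth)
  with False have "int n \<le> fls_subdegree (ls_frac f)"
    by (intro fls_subdegree_geI)
  then have "(2::real) powi (- fls_subdegree (ls_frac f)) \<le> 2 powi (- int n)"
    by (intro power_int_increasing) auto
  then show ?thesis using False
    by (simp add: ls_norm_eq ls_abs_def power_int_minus power_one_over inverse_eq_divide)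
qed

lemma mahler_g_in_ELC_delta:
  fixes u :: rat
  assumes "u \<notin> {-1, 0, 1}"
  shows "mahler_g u \<in> ELC_delta (1 / 2)"
proof -
  have "ls_abs (ls_of_poly q) * ls_norm (ls_of_poly q * fls_X_inv ^ k * mahler_g u) \<ge> 1 / 2"
    if q: "q \<noteq> 0" for q k
  proof -
    obtain i where "i \<le> degree q" "moment (fps_nth (mahler_limit u)) (k + i) q \<noteq> 0"
      using mahler_seq_nondegenerate[OF mahler_seq_mahler_limit mahler_limit_nth_0 assms q] by blast
    then show ?thesis using littlewood_term_ge[OF q] littlewood_term_nth by metis
  qed
  then have "littlewood_inf (mahler_g u) \<ge> 1 / 2"
    unfolding littlewood_inf_def
  proof (intro cINF_greatest)
    have "(1 :: rat poly, 0 :: nat) \<in> (UNIV - {0}) \<times> UNIV" by simp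
    then show "(UNIV - {0 :: rat poly}) \<times> (UNIV :: nat set) \<noteq> {}" by blast
  qed auto
  then show ?thesis by (simp add: ELC_delta_def)
qed

section \<open>Arbitrarily small products for \<open>u = -1\<close>\<close>

context mahler_seq
begin

text \<open>The binary digits of \<open>j * 2 ^ m\<close> and \<open>r\<close> do not overlap, so
  digit sums add. The factor \<open>a 0\<close> makes the identity homogeneous.\<close>

lemma seq_digits:
  assumes "r < 2 ^ m"
  shows "a 0 * a (j * 2 ^ m + r) = a j * a r"
  using assms
proof (induction m arbitrary: r)
  case 0
  then show ?case by (simp add: mult.commute)
next
  case (Suc m)
  have r: "r div 2 < 2 ^ m" using Suc.prems by auto
  show ?case
  proof (cases "even r")
    case True
    then have e: "j * 2 ^ Suc m + r = 2 * (j * 2 ^ m + r div 2)" "r = 2 * (r div 2)" by auto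
    show ?thesis using Suc.IH[OF r] a_even[of "r div 2"] a_even[of "j * 2 ^ m + r div 2"] e by metis
  next
    case False
    then have e: "j * 2 ^ Suc m + r = Suc (2 * (j * 2 ^ m + r div 2))" "r = Suc (2 * (r div 2))"
      by auto
    then have "a 0 * a (j * 2 ^ Suc m + r) = u * (a 0 * a (j * 2 ^ m + r div 2))"
      using a_odd[of "j * 2 ^ m + r div 2"] by (metis mult.left_commute)
    also have "\<dots> = a j * a r" using Suc.IH[OF r] a_odd[of "r div 2"] e(2) by (simp add: mult_ac)
    finally show ?thesis .
  qed
qed

end

lemma mahler_g_minus_1_not_ELC: "mahler_g (-1 :: 'a::field) \<notin> ELC"
proof
  assume "mahler_g (-1 :: 'a) \<in> ELC"
  define a where "a = fps_nth (mahler_limit (-1 :: 'a))"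
  interpret mahler_seq a "-1" unfolding a_def by (rule mahler_seq_mahler_limit)
  have a0: "a 0 = 1" by (simp add: a_def mahler_limit_nth_0)
  define I where "I = littlewood_inf (mahler_g (-1 :: 'a))"
  have "I > 0" using \<open>mahler_g (-1) \<in> ELC\<close> by (simp add: ELC_def I_def)
  have le: "I \<le> (1 / 2) ^ m" for m
  proof -
    define M :: nat where "M = 2 ^ m"
    define q where "q = monom (1 :: 'a) M + 1"
    have "M > 0" "M \<ge> m" by (simp_all add: M_def less_imp_le)
    have "coeff q M = 1" using \<open>M > 0\<close> by (simp add: q_def)
    then have "q \<noteq> 0" by auto
    have deg: "degree q = M"
      using \<open>M > 0\<close> unfolding q_def by (simp add: degree_add_eq_left degree_monom_eq)
    have moment_q: "moment a k q = a (M + k) + a k" for k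
    proof -
      have "moment a k (monom 1 M) = a (k + M)"
        by (simp add: moment_def degree_monom_eq if_distrib[of "\<lambda>x. x * _"] cong: if_cong)
      then show ?thesis by (simp add: q_def add.commute)
    qed
    \<comment> \<open>The signs alternate from index 2 to 5, giving three neighbouring pairs with
      sum 0; each accounts for one block of \<open>M\<close> zeros below.\<close>
    have small: "a 1 = -1" "a 2 = -1" "a 3 = 1" "a 4 = -1" "a 5 = 1"
      using a_odd[of 0] a_even[of 1] a_odd[of 1] a_even[of 2] a_odd[of 2] a0
      by (simp_all add: eval_nat_numeral)
    have zero: "moment a (2 * M + i) q = 0" if "i < 3 * M" for i
    proof -
      define j where "j = i div M"
      define r where "r = i mod M"
      have i: "i = j * M + r" "r < M" using \<open>M > 0\<close> by (simp_all add: j_def r_def)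
      have "j < 3" using that by (simp add: j_def less_mult_imp_div_less)
      then have j: "j = 0 \<or> j = 1 \<or> j = 2" by auto
      have "2 * M + i = (j + 2) * M + r" "M + (2 * M + i) = (j + 3) * M + r"
        by (simp_all add: i(1) algebra_simps)
      then have "moment a (2 * M + i) q = a ((j + 3) * M + r) + a ((j + 2) * M + r)"
        by (simp only: moment_q)
      also have "\<dots> = a (j + 3) * a r + a (j + 2) * a r"
        using seq_digits[of r m "j + 3"] seq_digits[of r m "j + 2"] i(2) a0 by (simp add: M_def)
      also have "\<dots> = 0" using j small by (auto simp: numeral_eq_Suc)
      finally show ?thesis .
    qed
    let ?f = "ls_of_poly q * fls_X_inv ^ (2 * M) * mahler_g (-1)"
    have "I \<le> ls_abs (ls_of_poly q) * ls_norm ?f"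
      unfolding I_def littlewood_inf_def
      using cINF_lower[OF littlewood_inf_bdd_below, of "(q, 2 * M)" "(UNIV - {0}) \<times> UNIV" "mahler_g (-1)"]
        \<open>q \<noteq> 0\<close> by simp
    also have "\<dots> \<le> 2 ^ M * (1 / 2) ^ (3 * M)"
      using ls_norm_le[of "3 * M" ?f] zero \<open>q \<noteq> 0\<close>
      by (simp add: ls_abs_ls_of_poly deg littlewood_term_nth a_def)
    also have "\<dots> = (1 / 2) ^ (2 * M)"
      by (simp add: power_divide field_simps flip: power_add)
    also have "\<dots> \<le> (1 / 2) ^ m"
      using \<open>M \<ge> m\<close> by (intro power_decreasing) auto
    finally show ?thesis .
  qed
  obtain m where "(1 / 2 :: real) ^ m < I" using real_arch_pow_inv[OF \<open>I > 0\<close>, of "1/2"] by auto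
  with le[of m] show False by simp
qed

section \<open>The Thue--Morse series modulo 2\<close>

declare add_bit_eq_xor [simp del] mult_bit_eq_and [simp del]

lemma bit_add_self [simp]: "x + x = (0 :: bit)"
  by (cases "x = 0") auto

lemma bit_mult_self [simp]: "x * x = (x :: bit)"
  by (cases "x = 0") auto

lemma of_int_bit_eq_0_iff: "(of_int n :: bit) = 0 \<longleftrightarrow> even n"
proof (cases "even n")
  case True
  then obtain m where "n = m + m" by (metis evenE mult_2)
  then show ?thesis using True by simp
next
  case False
  then obtain m where "n = m + m + 1" by (metis oddE mult_2)
  then show ?thesis using False by simp
qed

text \<open>The terms at \<open>i\<close> and \<open>n - i\<close> cancel in characteristic 2,
  leaving only a middle term.\<close>

lemma symmetric_sum_bit:
  fixes G :: "nat \<Rightarrow> bit"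
  assumes "\<And>i. i \<le> n \<Longrightarrow> G i = G (n - i)"
  shows "sum G {..n} = (if even n then G (n div 2) else 0)"
  using assms
proof (induction n arbitrary: G rule: less_induct)
  case (less n)
  consider "n = 0" | "n = 1" | m where "n = Suc (Suc m)" by (metis not0_implies_Suc One_nat_def)
  then show ?case
  proof cases
    case 2
    then show ?thesis using less.prems[of 0] by simp
  next
    case (3 m)
    have "sum G {..n} = G n + (G 0 + (\<Sum>i\<le>m. G (Suc i)))"
      unfolding 3 by (subst sum.atMost_Suc, subst sum.atMost_Suc_shift) (simp add: add.commute)
    also have "\<dots> = G 0 + G 0 + (\<Sum>i\<le>m. G (Suc i))"
      using less.prems[of 0] by (simp add: add.assoc)
    also have "\<dots> = (\<Sum>i\<le>m. G (Suc i))" by simp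
    also have "\<dots> = (if even m then G (Suc (m div 2)) else 0)"
    proof (rule less.IH)
      show "G (Suc i) = G (Suc (m - i))" if "i \<le> m" for i
        using less.prems[of "Suc i"] that 3 by (simp add: Suc_diff_le)
    qed (use 3 in simp)
    finally show ?thesis using 3 by simp
  qed simp
qed

lemma bit_fps_square_nth:
  fixes f :: "bit fps"
  shows "(f * f) $ n = (if even n then f $ (n div 2) else 0)"
proof -
  have "(f * f) $ n = (\<Sum>i\<le>n. f $ i * f $ (n - i))"
    by (simp add: fps_mult_nth atMost_atLeast0)
  also have "\<dots> = (if even n then f $ (n div 2) * f $ (n - n div 2) else 0)"
    by (rule symmetric_sum_bit) (simp add: mult.commute)
  also have "\<dots> = (if even n then f $ (n div 2) else 0)"
    by (auto simp: mult_2 elim!: evenE)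
  finally show ?thesis .
qed

text \<open>Denominators of the convergents of the continued fraction with all partial quotients t +
  1. As these are constant, the numerator at \<open>Suc n\<close> is
  \<open>cf_denom n\<close>.\<close>

fun cf_denom :: "nat \<Rightarrow> bit poly" where
  "cf_denom 0 = 1"
| "cf_denom (Suc 0) = [:1, 1:]"
| "cf_denom (Suc (Suc n)) = cf_denom (Suc n) + pCons 0 (cf_denom (Suc n)) + cf_denom n"

lemma cf_denom_monic: "coeff (cf_denom n) n = 1 \<and> degree (cf_denom n) \<le> n"
proof (induction n rule: cf_denom.induct)
  case (3 n)
  have "degree (cf_denom (Suc (Suc n))) \<le> Suc (Suc n)"
    using 3 by (auto intro!: degree_add_le le_trans[OF degree_pCons_le])
  then show ?case using 3 by (simp add: coeff_eq_0)
qed simp_all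

text \<open>The quadratic equation turns each step of the recurrence into multiplication by
  \<open>E\<close>. Signs are immaterial over \<open>bit\<close>.\<close>

lemma cf_denom_error:
  fixes E :: "bit fls"
  assumes E: "E * E = fls_X_inv * E + E + 1"
  shows "ls_of_poly (cf_denom (Suc n)) * E + ls_of_poly (cf_denom n) = E ^ (n + 2)"
proof (induction n)
  case 0
  have "ls_of_poly [:1, 1:] = 1 + (fls_X_inv :: bit fls)"
    by (simp add: ls_of_poly_pCons)
  then show ?case by (simp add: power2_eq_square E distrib_right add_ac)
next
  case (Suc n)
  define A where "A = ls_of_poly (cf_denom (Suc n))"
  define B where "B = ls_of_poly (cf_denom n)"
  have "ls_of_poly (cf_denom (Suc (Suc n))) = A + fls_X_inv * A + B"
    by (simp add: A_def B_def ls_of_poly_add ls_of_poly_pCons)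
  then have "ls_of_poly (cf_denom (Suc (Suc n))) * E + A = A * (fls_X_inv * E + E + 1) + B * E"
    by (simp add: algebra_simps)
  also have "\<dots> = (A * E + B) * E" unfolding E[symmetric] by (simp add: algebra_simps)
  also have "\<dots> = E ^ (Suc n + 2)" using Suc by (simp add: A_def B_def)
  finally show ?case by (simp add: A_def)
qed

text \<open>The recursion for \<open>e\<close> is a quadratic equation for its series, whose
  continued fraction denominators are the orthogonal polynomials, all of norm 1.\<close>

lemma quadratic_nondegenerate:
  fixes e :: "nat \<Rightarrow> bit"
  assumes start: "e 0 = 1" and odd: "\<And>n. e (Suc (2 * n)) = e (2 * n)"
    and even: "\<And>n. e (2 * Suc n) = e (Suc (2 * n)) + e n"
    and q: "q \<noteq> 0"
  shows "\<exists>i\<le>degree q. moment e i q \<noteq> 0"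
proof -
  define F where "F = Abs_fps e"
  define E where "E = fls_X * fps_to_fls F"
  \<comment> \<open>Squaring is F(x) to F(x^2) in characteristic 2, so the three cases of the index
    are exactly \<open>start\<close>, \<open>odd\<close> and \<open>even\<close>.\<close>
  have F: "fps_X\<^sup>2 * (F * F) = (1 + fps_X) * F + 1"
  proof (rule fps_ext)
    fix n
    consider "n = 0" | m where "n = Suc (2 * m)" | m where "n = 2 * Suc m"
      by (metis evenE oddE Suc_eq_plus1 mult_0_right not0_implies_Suc)
    then show "(fps_X\<^sup>2 * (F * F)) $ n = ((1 + fps_X) * F + 1) $ n"
    proof cases
      case 1
      then show ?thesis
        by (simp add: fps_X_power_mult_nth distrib_right F_def start)
    next
      case (2 m)
      have "(F * F) $ (n - 2) = 0" if "n \<ge> 2" using that 2 by (simp add: bit_fps_square_nth)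
      then have "(fps_X\<^sup>2 * (F * F)) $ n = 0" by (auto simp: fps_X_power_mult_nth)
      then show ?thesis using 2 odd[of m] by (simp add: distrib_right F_def)
    next
      case (3 m)
      have "(fps_X\<^sup>2 * (F * F)) $ n = e m"
        using 3 bit_fps_square_nth[of F "2 * m"] by (simp add: fps_X_power_mult_nth F_def)
      moreover have "((1 + fps_X) * F + 1) $ n = e n + e (Suc (2 * m))"
        using 3 by (simp add: distrib_right F_def)
      ultimately show ?thesis using 3 even[of m] by (simp add: add_ac)
    qed
  qed
  have X: "fls_X_inv * (fls_X * f) = f" for f :: "bit fls"
    by (simp add: fls_X_times_conv_shift fls_X_inv_times_conv_shift)
  have "E * E = fps_to_fls (fps_X\<^sup>2 * (F * F))"
    by (simp add: E_def fls_times_fps_to_fls power2_eq_square mult_ac)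
  also have "\<dots> = fls_X_inv * E + E + 1"
    unfolding F E_def X by (simp add: fls_times_fps_to_fls distrib_right)
  finally have EE: "E * E = fls_X_inv * E + E + 1" .
  have E_power: "(E ^ Suc n) $$ (int i + 1) = (if i < n then 0 else if i = n then 1 else (F ^ Suc n) $ (i - n))"
    for n i
  proof -
    have "E ^ Suc n = fps_to_fls (fps_X ^ Suc n * F ^ Suc n)"
      by (simp only: E_def power_mult_distrib fls_times_fps_to_fls fps_to_fls_power fps_X_to_fls)
    then have "(E ^ Suc n) $$ (int i + 1) = (fps_X ^ Suc n * F ^ Suc n) $ (Suc i)"
      by (simp only: fps_to_fls_nth) (simp add: nat_add_distrib)
    also have "\<dots> = (if i < n then 0 else (F ^ Suc n) $ (i - n))"
      by (simp only: fps_X_power_mult_nth) simp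
    finally show ?thesis by (auto simp: F_def start fps_power_zeroth simp del: power_Suc)
  qed
  have E_nth: "E $$ (int n + 1) = e n" for n
    by (simp add: E_def fls_X_times_conv_shift F_def)
  have moment_denom: "moment e i (cf_denom n) = (E ^ Suc n) $$ (int i + 1)" for i n
  proof -
    have l: "(ls_of_poly (cf_denom n) * E) $$ (int i + 1) = moment e i (cf_denom n)"
      by (rule ls_of_poly_times_nth) (rule E_nth)
    show ?thesis
    proof (cases n)
      case 0
      then show ?thesis using l by simp
    next
      case (Suc m)
      have "(ls_of_poly (cf_denom n) * E) $$ (int i + 1) + ls_of_poly (cf_denom m) $$ (int i + 1)
          = (E ^ Suc n) $$ (int i + 1)"
        using cf_denom_error[OF EE, of m] Suc by (simp flip: fls_plus_nth)
      \<comment> \<open>The numerator is a polynomial and does not touch the fractional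
        part.\<close>
      moreover have "ls_of_poly (cf_denom m) $$ (int i + 1) = 0" by (simp add: ls_of_poly_nth)
      ultimately show ?thesis using l by simp
    qed
  qed
  have "orth e 0 n (cf_denom n)" for n
    using cf_denom_monic[of n] by (simp add: orth_def moment_denom E_power del: power_Suc)
  moreover have "moment e (0 + n) (cf_denom n) \<noteq> 0" for n
    by (simp add: moment_denom E_power del: power_Suc)
  ultimately show ?thesis using orth_nondegenerate[of e 0 q] q by auto
qed

section \<open>Nondegeneracy for Thue--Morse by reduction modulo 2\<close>

lemma clear_denominators:
  fixes q :: "rat poly"
  obtains d z where "d \<noteq> 0" "smult (of_int d) q = map_poly of_int z"
proof -
  have "\<exists>d z. d \<noteq> 0 \<and> smult (of_int d) q = map_poly of_int z"
  proof (induction q)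
    case 0
    show ?case by (intro exI[of _ 1] exI[of _ 0]) simp
  next
    case (pCons x q)
    then obtain d z where d: "d \<noteq> 0" "smult (of_int d) q = map_poly of_int z" by blast
    obtain n m where nm: "quotient_of x = (n, m)" by (cases "quotient_of x")
    then have x: "x = of_int n / of_int m" "m > 0"
      by (auto simp: quotient_of_div quotient_of_denom_pos)
    have "smult (of_int (d * m)) (pCons x q) = pCons (of_int (d * n)) (smult (of_int m) (smult (of_int d) q))"
      using x by (simp add: mult.commute)
    also have "\<dots> = map_poly of_int (pCons (d * n) (smult m z))"
      unfolding d by (simp add: map_poly_pCons map_poly_smult)
    finally show ?case using d x by (intro exI[of _ "d * m"]) auto
  qed
  then show ?thesis using that by blast
qed

text \<open>Content 1 ensures that the polynomial stays nonzero modulo 2.\<close>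

lemma primitive_multiple:
  fixes q :: "rat poly"
  assumes "q \<noteq> 0"
  obtains c z where "c \<noteq> 0" "smult c q = map_poly of_int z" "Polynomial.content z = 1" "degree z = degree q"
proof -
  obtain d y where d: "d \<noteq> 0" "smult (of_int d) q = map_poly of_int y"
    using clear_denominators by blast
  have y: "y \<noteq> 0" using d assms by auto
  define z where "z = primitive_part y"
  have "smult (of_int d) q = smult (of_int (Polynomial.content y)) (map_poly of_int z)"
    unfolding d
    by (subst content_times_primitive_part[of y, symmetric]) (simp only: map_poly_smult z_def of_int_0 of_int_mult)
  from arg_cong[OF this, of "smult (inverse (of_int (Polynomial.content y)))"]
  have eq: "smult (of_int d / of_int (Polynomial.content y)) q = map_poly of_int z"
    using y by (simp add: divide_inverse mult.commute)
  have "degree (map_poly rat_of_int z) = degree z" by (rule degree_map_poly) simp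
  then have "degree z = degree q" using d y arg_cong[OF eq, of degree] by simp
  moreover have "Polynomial.content z = 1" using y by (simp add: z_def)
  ultimately show ?thesis using that[OF _ eq] d y by simp
qed

lemma thue_morse_nondegenerate:
  fixes a :: "nat \<Rightarrow> rat"
  assumes seq: "mahler_seq a (-1)" "a 0 = 1" and q: "q \<noteq> 0"
  shows "\<exists>i\<le>degree q. moment a i q \<noteq> 0"
proof (rule ccontr)
  assume neg: "\<not> ?thesis"
  interpret mahler_seq a "-1" by fact
  have pm: "a n = 1 \<or> a n = -1" for n
  proof (induction n rule: less_induct)
    case (less n)
    show ?case
    proof (cases "n = 0")
      case False
      then have "a (n div 2) = 1 \<or> a (n div 2) = -1" using less by simp
      then show ?thesis using a_even[of "n div 2"] a_odd[of "n div 2"] by (cases "even n") auto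
    qed (use seq in simp)
  qed
  define b where "b n = \<lfloor>a n\<rfloor>" for n
  have ab: "a n = of_int (b n)" for n using pm[of n] by (auto simp: b_def)
  have b_odd: "odd (b n)" for n
    using pm[of n] unfolding ab by (metis of_int_1 of_int_minus of_int_eq_iff odd_one even_minus)
  have b_bit: "(of_int (b n) :: bit) = 1" for n
    using b_odd[of n] of_int_bit_eq_0_iff[of "b n"] by simp
  have b_even_index: "b (2 * n) = b n" and b_odd_index: "b (Suc (2 * n)) = - b n" for n
    using a_even[of n] a_odd[of n] unfolding ab by (simp_all flip: of_int_minus)
  \<comment> \<open>Modulo 2 the sequence \<open>b\<close> is constantly 1 and carries no
    information; halved sums of neighbours do.\<close>
  define c where "c n = (b n + b (Suc n)) div 2" for n
  have c2: "2 * c n = b n + b (Suc n)" for n using b_odd by (simp add: c_def)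
  define c' where "c' n = (of_int (c n) :: bit)" for n
  have c'_even: "c' (2 * n) = 0" for n
    using c2[of "2 * n"] by (simp add: c'_def b_even_index b_odd_index)
  have c'_odd: "c' (Suc (2 * n)) = c' n + 1" for n
  proof -
    have "2 * c (Suc (2 * n)) = 2 * (c n - b n)"
      using c2[of n] c2[of "Suc (2 * n)"] b_even_index[of "Suc n"] by (simp add: b_odd_index)
    then have "c (Suc (2 * n)) = c n - b n" by simp
    then show ?thesis by (simp only: c'_def of_int_diff b_bit) simp
  qed
  \<comment> \<open>A second sum of neighbours removes the inhomogeneous 1 in \<open>c'_odd\<close>
    and yields the recursion of \<open>quadratic_nondegenerate\<close>.\<close>
  define e where "e n = c' n + c' (Suc n)" for n
  have e_even: "e (2 * n) = c' n + 1" for n by (simp add: e_def c'_even c'_odd)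
  have e_odd: "e (Suc (2 * n)) = c' n + 1" for n
    using c'_even[of "Suc n"] by (simp add: e_def c'_odd)
  have e_nondeg: "\<exists>i\<le>degree r. moment e i r \<noteq> 0" if "r \<noteq> 0" for r
  proof (rule quadratic_nondegenerate[OF _ _ _ that])
    show "e 0 = 1" using e_even[of 0] c'_even[of 0] by simp
    show "e (Suc (2 * n)) = e (2 * n)" for n by (simp add: e_even e_odd)
    have "c' (Suc n) + 1 = c' n + 1 + (c' n + c' (Suc n))" for n
    proof -
      have "c' n + 1 + (c' n + c' (Suc n)) = (c' n + c' n) + (c' (Suc n) + 1)" by (simp only: add_ac)
      then show ?thesis by simp
    qed
    then show "e (2 * Suc n) = e (Suc (2 * n)) + e n" for n
      unfolding e_even e_odd by (simp only: e_def)
  qed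
  obtain x z where z: "x \<noteq> 0" "smult x q = map_poly of_int z" "Polynomial.content z = 1" "degree z = degree q"
    using primitive_multiple[OF q] by blast
  define d where "d = degree q"
  have zb: "(\<Sum>j\<le>d. coeff z j * b (i + j)) = 0" if "i \<le> d" for i
  proof -
    have "moment a i (smult x q) = 0" using neg that by (simp add: d_def)
    then have "moment a i (map_poly of_int z) = 0" unfolding z .
    moreover have "moment a i (map_poly of_int z) = (\<Sum>j\<le>d. coeff (map_poly of_int z) j * a (i + j))"
      by (rule moment_eq_sum) (simp add: d_def degree_map_poly flip: z(4))
    ultimately have "(\<Sum>j\<le>d. of_int (coeff z j) * of_int (b (i + j))) = (0 :: rat)"
      by (simp add: ab coeff_map_poly)
    then have "rat_of_int (\<Sum>j\<le>d. coeff z j * b (i + j)) = 0" by simp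
    then show ?thesis by (simp only: of_int_eq_0_iff)
  qed
  define y where "y = map_poly (of_int :: int \<Rightarrow> bit) z"
  have y_deg: "degree y \<le> d"
    by (rule degree_le) (simp add: y_def d_def coeff_map_poly coeff_eq_0 flip: z(4))
  have cy: "coeff y j = of_int (coeff z j)" for j by (simp add: y_def coeff_map_poly)
  have "y \<noteq> 0"
  proof
    assume "y = 0"
    then have "even (coeff z j)" for j using cy[of j] of_int_bit_eq_0_iff by simp
    then have "[:2:] dvd z" by (simp add: const_poly_dvd_iff)
    then have "2 dvd Polynomial.content z" by (simp add: const_poly_dvd_iff_dvd_content)
    then show False using z by simp
  qed
  \<comment> \<open>Since every \<open>b j\<close> is odd, the relation \<open>zb\<close> at 0 reads
    modulo 2 as the vanishing of the coefficient sum.\<close>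
  have "poly y 1 = 0"
  proof -
    have "poly y 1 = moment (\<lambda>_. 1) 0 y" by (simp add: poly_altdef moment_def)
    also have "\<dots> = (\<Sum>j\<le>d. of_int (coeff z j) * of_int (b (0 + j)))"
      unfolding moment_eq_sum[OF y_deg] by (simp add: cy b_bit)
    also have "\<dots> = of_int (\<Sum>j\<le>d. coeff z j * b (0 + j))" by (simp only: of_int_sum of_int_mult)
    finally show ?thesis by (simp only: zb[OF le0] of_int_0)
  qed
  then obtain r where r: "y = [:-1, 1:] * r" by (auto simp: poly_eq_0_iff_dvd)
  have "r \<noteq> 0" using r \<open>y \<noteq> 0\<close> by auto
  then have "degree y = Suc (degree r)" unfolding r by (subst degree_mult_eq) simp_all
  then have r_deg: "degree r < d" using y_deg by simp
  \<comment> \<open>Adding the relations at \<open>i\<close> and \<open>Suc i\<close> costs one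
    index. The division of \<open>y\<close> by t - 1 lowers the degree by one as well, so enough
    conditions remain for \<open>r\<close>.\<close>
  have moment_y: "moment c' i y = 0" if "i < d" for i
  proof -
    have "2 * (\<Sum>j\<le>d. coeff z j * c (i + j)) = (\<Sum>j\<le>d. coeff z j * (2 * c (i + j)))"
      by (simp add: sum_distrib_left mult.left_commute)
    also have "\<dots> = (\<Sum>j\<le>d. coeff z j * b (i + j)) + (\<Sum>j\<le>d. coeff z j * b (Suc i + j))"
      unfolding c2 by (simp add: distrib_left sum.distrib)
    also have "\<dots> = 0" using zb[of i] zb[of "Suc i"] that by simp
    finally have "(\<Sum>j\<le>d. coeff z j * c (i + j)) = 0" by simp
    then have "(of_int (\<Sum>j\<le>d. coeff z j * c (i + j)) :: bit) = 0" by simp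
    then show ?thesis unfolding moment_eq_sum[OF y_deg] by (simp add: cy c'_def)
  qed
  \<comment> \<open>The factor t - 1 acts on \<open>c'\<close> as the neighbour sum defining
    \<open>e\<close>, since -1 = 1 in \<open>bit\<close>.\<close>
  have "moment e i r = moment c' i y" for i
  proof -
    have "moment e i r = moment c' i r + moment c' (Suc i) r"
      by (simp add: moment_def e_def distrib_left sum.distrib)
    then show ?thesis by (simp add: r)
  qed
  moreover obtain i where "i \<le> degree r" "moment e i r \<noteq> 0" using e_nondeg[OF \<open>r \<noteq> 0\<close>] by blast
  ultimately show False using moment_y[of i] r_deg by simp
qed

lemma mahler_g_minus_1_Bad: "mahler_g (-1 :: rat) \<in> Bad_delta (1 / 2)"
proof -
  have ge: "ls_abs (ls_of_poly q) * ls_norm (ls_of_poly q * mahler_g (-1 :: rat)) \<ge> 1 / 2"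
    if q: "q \<noteq> 0" for q
  proof -
    obtain i where "i \<le> degree q" "moment (fps_nth (mahler_limit (-1 :: rat))) i q \<noteq> 0"
      using thue_morse_nondegenerate[OF mahler_seq_mahler_limit mahler_limit_nth_0 q] by blast
    then show ?thesis
      using littlewood_term_ge[OF q, of i "ls_of_poly q * mahler_g (-1)"]
        littlewood_term_nth[of q 0 "-1" i] by simp
  qed
  \<comment> \<open>Along |q| to infinity the only excluded polynomial, 0, is eventually left
    behind.\<close>
  have "eventually (\<lambda>q :: rat poly. ls_abs (ls_of_poly q) > 0) (filtercomap (\<lambda>q. ls_abs (ls_of_poly q)) at_top)"
    by (rule eventually_filtercomapI) (rule eventually_gt_at_top)
  then have "eventually (\<lambda>q :: rat poly. ereal (1 / 2) \<le>
      ereal (ls_abs (ls_of_poly q) * ls_norm (ls_of_poly q * mahler_g (-1))))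
      (filtercomap (\<lambda>q. ls_abs (ls_of_poly q)) at_top)"
  proof eventually_elim
    case (elim q)
    then have "q \<noteq> 0" by (auto simp: ls_abs_def)
    then show ?case using ge by simp
  qed
  then show ?thesis unfolding Bad_delta_def by (simp add: Liminf_bounded)
qed

theorem theorem2:
  fixes u :: rat
  shows "(u \<notin> {-1, 0, 1} \<longrightarrow> mahler_g u \<in> ELC_delta (1/2)) \<and>
         (u = -1 \<longrightarrow> mahler_g u \<in> Bad_delta (1/2) - ELC)"
  using mahler_g_in_ELC_delta mahler_g_minus_1_Bad mahler_g_minus_1_not_ELC by blast

end
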